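(* For every $n\ge 1$, the set $\operatorname{val}(\mathrm{GL}_n\cap\mathsf{TN})$ of entrywise valuations of the invertible totally nonnegative $n\times n$ matrices over $\mathbb{K}$ is equal to the multiplicative semigroup (for the tropical matrix product) generated by the $n\times n$ tropical Jacobi elementary matrices, i.e. to the set of all finite tropical products of such matrices.
   Context: $\mathbb{K}$ is the field of generalized Puiseux series with real coefficients and real exponents: series $f=\sum_{k\ge 0}a_kt^{b_k}$ with $a_k\in\mathbb{R}$ and $(b_k)$ a finite sequence, or a strictly decreasing sequence of reals tending to $-\infty$. The valuation $\operatorname{val}(f)$ is the largest exponent with nonzero coefficient, $\operatorname{val}(0)=-\infty$. $\mathbb{K}$ is ordered: a nonzero series is positive if its leading coefficient (that of the largest exponent) is positive. $\mathrm{GL}_n$ is the set of invertible $n\times n$ matrices over $\mathbb{K}$, and $\mathsf{TN}$ is the set of matrices over $\mathbb{K}$ all of whose minors are nonnegative. $\operatorname{val}$ is applied to matrices entrywise. The tropical semifield $\mathbb{R}_{\max}$ is $\mathbb{R}\cup\{-\infty\}$ with $a\oplus b=\max(a,b)$ and $a\odot b=a+b$; the tropical matrix product is $(A\odot B)_{ij}=\max_k(A_{ik}+B_{kj})$. The tropical identity matrix has $0$ on the diagonal and $-\infty$ elsewhere. A tropical Jacobi elementary matrix is a matrix over $\mathbb{R}_{\max}$ that differs from the tropical identity matrix in at most one entry, which must be finite and located either on the main diagonal or immediately above or below it. *)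

theory Defs
  imports "Jordan_Normal_Form.Determinant" "Jordan_Normal_Form.DL_Submatrix"
begin

section \<open>Generalized Puiseux series with real coefficients and real exponents\<close>

text \<open>
  A series \<open>\<Sum>k. a k * t powr b k\<close> is represented by its coefficient function, sending an exponent
  to its coefficient. Some of the \<open>a k\<close> may vanish, so the set of exponents with nonzero
  coefficient need only be contained in the set of the \<open>b k\<close>.
\<close>

definition puiseux_support :: "real set \<Rightarrow> bool" where
  "puiseux_support S \<longleftrightarrow>
     finite S \<or>
     (\<exists>b :: nat \<Rightarrow> real. (\<forall>k. b (Suc k) < b k) \<and> filterlim b at_bot sequentially \<and> S \<subseteq> range b)"

lemma puiseux_support_iff: "puiseux_support S \<longleftrightarrow> (\<forall>c. finite {x \<in> S. c \<le> x})"
proof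
  assume S: "puiseux_support S"
  show "\<forall>c. finite {x \<in> S. c \<le> x}"
  proof (cases "finite S")
    case False
    with S obtain b :: "nat \<Rightarrow> real" where
      lim: "filterlim b at_bot sequentially" and sub: "S \<subseteq> range b"
      unfolding puiseux_support_def by blast
    show ?thesis
    proof
      fix c
      have "eventually (\<lambda>k. b k < c) sequentially"
        using lim by (simp add: filterlim_at_bot_dense)
      then obtain N where N: "\<And>k. k \<ge> N \<Longrightarrow> b k < c"
        by (auto simp: eventually_sequentially)
      have "{x \<in> S. c \<le> x} \<subseteq> b ` {..<N}"
      proof clarify
        fix x assume x: "x \<in> S" "c \<le> x"
        then obtain k where "x = b k" using sub by blast
        with N[of k] x show "x \<in> b ` {..<N}" by (cases "k < N") auto
      qed
      then show "finite {x \<in> S. c \<le> x}"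
        by (rule finite_subset) simp
    qed
  qed simp
next
  assume fin: "\<forall>c. finite {x \<in> S. c \<le> x}"
  show "puiseux_support S"
  proof (cases "finite S")
    case True
    then show ?thesis by (simp add: puiseux_support_def)
  next
    case False
    have "\<exists>m\<in>S. m < c \<and> (\<forall>y\<in>S. y < c \<longrightarrow> y \<le> m)" for c
    proof -
      have "\<not> S \<subseteq> {x \<in> S. c \<le> x}"
        using False fin finite_subset by blast
      then obtain x0 where x0: "x0 \<in> S" "x0 < c" by force
      let ?T = "{y \<in> {x \<in> S. x0 \<le> x}. y < c}"
      have "finite ?T"
        by (rule finite_subset[of _ "{x \<in> S. x0 \<le> x}"]) (use fin in auto)
      moreover have "x0 \<in> ?T" using x0 by simp
      ultimately have T: "finite ?T" "x0 \<in> ?T" by blast+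
      then have "Max ?T \<in> ?T" using Max_in[OF T(1)] by blast
      moreover have "y \<le> Max ?T" if "y \<in> S" "y < c" for y
      proof (cases "x0 \<le> y")
        case True
        then show ?thesis using T that by (intro Max_ge) auto
      next
        case False
        then show ?thesis using Max_ge[OF T] by linarith
      qed
      ultimately show ?thesis by blast
    qed
    then obtain nx where nx: "\<And>c. nx c \<in> S" "\<And>c. nx c < c" "\<And>c y. y \<in> S \<Longrightarrow> y < c \<Longrightarrow> y \<le> nx c"
      by metis
    have "bdd_above {x \<in> S. 0 \<le> x}" using fin by (simp add: bdd_above_finite)
    then obtain c1 where c1: "\<And>x. x \<in> S \<Longrightarrow> 0 \<le> x \<Longrightarrow> x \<le> c1"
      unfolding bdd_above_def by blast
    define c0 where "c0 = max c1 0 + 1"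
    have c0: "x < c0" if "x \<in> S" for x
      using c1[OF that] by (cases "0 \<le> x") (auto simp: c0_def)
    define b where "b k = (nx ^^ Suc k) c0" for k
    have dec: "b (Suc k) < b k" for k using nx(2) by (simp add: b_def)
    have inS: "b k \<in> S" for k using nx(1) by (simp add: b_def)
    have anti: "b j < b i" if "i < j" for i j
      using that
    proof (induction j)
      case (Suc j)
      then show ?case using dec[of j] by (cases "i = j") auto
    qed simp
    have inj: "inj b"
      by (rule injI) (metis anti less_irrefl linorder_neqE_nat)
    have ex: "\<exists>k. b k < c" for c
    proof (rule ccontr)
      assume "\<not> ?thesis"
      then have "range b \<subseteq> {x \<in> S. c \<le> x}" using inS by (auto simp: not_less)
      then have "finite (range b)" using fin finite_subset by blast
      then show False using inj finite_imageD infinite_UNIV_nat by blast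
    qed
    have lim: "filterlim b at_bot sequentially"
      unfolding filterlim_at_bot_dense eventually_sequentially
    proof (intro allI)
      fix c
      obtain k where "b k < c" using ex by blast
      then have "b j < c" if "k \<le> j" for j
        using that anti[of k j] by (cases "k = j") auto
      then show "\<exists>N. \<forall>n\<ge>N. b n < c" by blast
    qed
    have "S \<subseteq> range b"
    proof
      fix x assume x: "x \<in> S"
      show "x \<in> range b"
      proof (rule ccontr)
        assume nr: "x \<notin> range b"
        have "x < c0" using c0 x by simp
        then have "x < b k" for k
        proof (induction k)
          case 0
          then have "x \<le> b 0" using nx(3)[OF x, of c0] by (simp add: b_def)
          moreover have "x \<noteq> b 0" using nr by blast
          ultimately show ?case by simp
        next
          case (Suc k)
          then have "x \<le> b (Suc k)" using nx(3)[OF x, of "b k"] by (simp add: b_def)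
          moreover have "x \<noteq> b (Suc k)" using nr by blast
          ultimately show ?case by simp
        qed
        then show False using ex[of x] less_asym by blast
      qed
    qed
    then show ?thesis
      unfolding puiseux_support_def using dec lim by blast
  qed
qed

typedef puiseux = "{f :: real \<Rightarrow> real. puiseux_support {x. f x \<noteq> 0}}"
  morphisms coeff_at Abs_puiseux
  by (rule exI[of _ "\<lambda>_. 0"]) (simp add: puiseux_support_def)

setup_lifting type_definition_puiseux

lemma puiseux_eqI: "(\<And>x. coeff_at f x = coeff_at g x) \<Longrightarrow> f = g"
  by (metis coeff_at_inject ext)

lemma finite_above: "finite {x. coeff_at f x \<noteq> 0 \<and> c \<le> x}"
  using coeff_at[of f] by (simp add: puiseux_support_iff)

lemma ex_upper_bound: "\<exists>B. \<forall>x. coeff_at f x \<noteq> 0 \<longrightarrow> x \<le> B"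
proof -
  have "bdd_above {x. coeff_at f x \<noteq> 0 \<and> 0 \<le> x}" by (simp add: finite_above bdd_above_finite)
  then obtain c where "\<And>x. coeff_at f x \<noteq> 0 \<Longrightarrow> 0 \<le> x \<Longrightarrow> x \<le> c"
    unfolding bdd_above_def by blast
  then have "coeff_at f x \<noteq> 0 \<Longrightarrow> x \<le> max c 0" for x
    by (cases "0 \<le> x") (auto simp: le_max_iff_disj)
  then show ?thesis by blast
qed

lemma finite_convolution: "finite {y. coeff_at f y \<noteq> 0 \<and> coeff_at g (x - y) \<noteq> 0}"
proof -
  obtain B where B: "\<And>x. coeff_at g x \<noteq> 0 \<Longrightarrow> x \<le> B" using ex_upper_bound by blast
  have "{y. coeff_at f y \<noteq> 0 \<and> coeff_at g (x - y) \<noteq> 0} \<subseteq> {y. coeff_at f y \<noteq> 0 \<and> x - B \<le> y}"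
  proof clarify
    fix y assume "coeff_at g (x - y) \<noteq> 0"
    then show "x - B \<le> y" using B[of "x - y"] by simp
  qed
  then show ?thesis by (rule finite_subset) (rule finite_above)
qed

lemma convolution_nonzeroE:
  assumes "(\<Sum>y\<in>{y. coeff_at f y \<noteq> 0 \<and> coeff_at g (x - y) \<noteq> 0}. coeff_at f y * coeff_at g (x - y)) \<noteq> 0"
  obtains y where "coeff_at f y \<noteq> 0" "coeff_at g (x - y) \<noteq> 0"
proof -
  have "{y. coeff_at f y \<noteq> 0 \<and> coeff_at g (x - y) \<noteq> 0} \<noteq> {}"
    using assms by (rule contrapos_nn) (simp only: sum.empty)
  then show ?thesis using that by blast
qed

subsection \<open>Ring structure\<close>

instantiation puiseux :: comm_ring_1
begin

lift_definition zero_puiseux :: puiseux is "\<lambda>_. 0"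
  by (simp add: puiseux_support_def)

lift_definition one_puiseux :: puiseux is "\<lambda>x. if x = 0 then 1 else 0"
  by (simp add: puiseux_support_def)

lift_definition plus_puiseux :: "puiseux \<Rightarrow> puiseux \<Rightarrow> puiseux" is "\<lambda>f g x. f x + g x"
proof -
  fix f g :: "real \<Rightarrow> real"
  assume "puiseux_support {x. f x \<noteq> 0}" "puiseux_support {x. g x \<noteq> 0}"
  then have fin: "finite {x. f x \<noteq> 0 \<and> c \<le> x}" "finite {x. g x \<noteq> 0 \<and> c \<le> x}" for c
    by (simp_all add: puiseux_support_iff)
  have "{x. f x + g x \<noteq> 0 \<and> c \<le> x} \<subseteq> {x. f x \<noteq> 0 \<and> c \<le> x} \<union> {x. g x \<noteq> 0 \<and> c \<le> x}" for c
    by auto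
  then have "finite {x. f x + g x \<noteq> 0 \<and> c \<le> x}" for c
    using fin by (metis (no_types, lifting) finite_UnI finite_subset)
  then show "puiseux_support {x. f x + g x \<noteq> 0}" by (simp add: puiseux_support_iff)
qed

lift_definition uminus_puiseux :: "puiseux \<Rightarrow> puiseux" is "\<lambda>f x. - f x"
  by simp

definition minus_puiseux :: "puiseux \<Rightarrow> puiseux \<Rightarrow> puiseux" where
  "minus_puiseux f g = f + - g"

lift_definition times_puiseux :: "puiseux \<Rightarrow> puiseux \<Rightarrow> puiseux" is
  "\<lambda>f g x. \<Sum>y\<in>{y. f y \<noteq> 0 \<and> g (x - y) \<noteq> 0}. f y * g (x - y)"
proof -
  fix f' g' :: "real \<Rightarrow> real"
  assume "puiseux_support {x. f' x \<noteq> 0}" "puiseux_support {x. g' x \<noteq> 0}"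
  then obtain f g where fg: "f' = coeff_at f" "g' = coeff_at g"
    by (metis Abs_puiseux_inverse mem_Collect_eq)
  obtain A where A: "\<And>x. coeff_at f x \<noteq> 0 \<Longrightarrow> x \<le> A" using ex_upper_bound by blast
  obtain B where B: "\<And>x. coeff_at g x \<noteq> 0 \<Longrightarrow> x \<le> B" using ex_upper_bound by blast
  let ?h = "\<lambda>x. \<Sum>y\<in>{y. coeff_at f y \<noteq> 0 \<and> coeff_at g (x - y) \<noteq> 0}. coeff_at f y * coeff_at g (x - y)"
  have "finite {x. ?h x \<noteq> 0 \<and> c \<le> x}" for c
  proof (rule finite_subset)
    show "{x. ?h x \<noteq> 0 \<and> c \<le> x} \<subseteq>
      (\<lambda>(y,z). y + z) ` ({y. coeff_at f y \<noteq> 0 \<and> c - B \<le> y} \<times> {z. coeff_at g z \<noteq> 0 \<and> c - A \<le> z})"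
    proof clarify
      fix x assume x: "?h x \<noteq> 0" "c \<le> x"
      from x(1) obtain y where y: "coeff_at f y \<noteq> 0" "coeff_at g (x - y) \<noteq> 0"
        by (rule convolution_nonzeroE)
      then have "c - B \<le> y" "c - A \<le> x - y" using A[OF y(1)] B[OF y(2)] x by linarith+
      then show "x \<in> (\<lambda>(y,z). y + z) `
        ({y. coeff_at f y \<noteq> 0 \<and> c - B \<le> y} \<times> {z. coeff_at g z \<noteq> 0 \<and> c - A \<le> z})"
        using y by (intro image_eqI[of _ _ "(y, x - y)"]) auto
    qed
  qed (simp add: finite_above)
  then show "puiseux_support {x. (\<Sum>y\<in>{y. f' y \<noteq> 0 \<and> g' (x - y) \<noteq> 0}. f' y * g' (x - y)) \<noteq> 0}"
    by (simp add: puiseux_support_iff fg)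
qed

lemma coeff_at_zero [simp]: "coeff_at 0 x = 0" by transfer simp
lemma coeff_at_one: "coeff_at 1 x = (if x = 0 then 1 else 0)" by transfer simp
lemma coeff_at_add [simp]: "coeff_at (f + g) x = coeff_at f x + coeff_at g x" by transfer simp
lemma coeff_at_uminus [simp]: "coeff_at (- f) x = - coeff_at f x" by transfer simp
lemma coeff_at_diff [simp]: "coeff_at (f - g) x = coeff_at f x - coeff_at g x"
  by (simp add: minus_puiseux_def)

lemma coeff_at_mult:
  "coeff_at (f * g) x = (\<Sum>y\<in>{y. coeff_at f y \<noteq> 0 \<and> coeff_at g (x - y) \<noteq> 0}. coeff_at f y * coeff_at g (x - y))"
  by transfer simp

lemma coeff_at_mult_left:
  assumes "finite A" "\<And>y. coeff_at f y \<noteq> 0 \<Longrightarrow> coeff_at g (x - y) \<noteq> 0 \<Longrightarrow> y \<in> A"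
  shows "coeff_at (f * g) x = (\<Sum>y\<in>A. coeff_at f y * coeff_at g (x - y))"
  unfolding coeff_at_mult using assms by (intro sum.mono_neutral_left) auto

lemma puiseux_mult_commute: "f * g = g * (f :: puiseux)"
proof (rule puiseux_eqI)
  fix x
  show "coeff_at (f * g) x = coeff_at (g * f) x"
    unfolding coeff_at_mult
    by (rule sum.reindex_bij_witness[of _ "\<lambda>y. x - y" "\<lambda>y. x - y"]) auto
qed

lemma coeff_at_mult_right:
  assumes "finite A" "\<And>y. coeff_at f (x - y) \<noteq> 0 \<Longrightarrow> coeff_at g y \<noteq> 0 \<Longrightarrow> y \<in> A"
  shows "coeff_at (f * g) x = (\<Sum>y\<in>A. coeff_at f (x - y) * coeff_at g y)"
  using coeff_at_mult_left[OF assms(1), of g f x] assms(2)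
  by (simp add: puiseux_mult_commute[of f g] mult.commute)

lemma puiseux_mult_assoc: "(f * g) * h = f * (g * h :: puiseux)"
proof (rule puiseux_eqI)
  fix x
  obtain B1 where B1: "\<And>x. coeff_at f x \<noteq> 0 \<Longrightarrow> x \<le> B1" using ex_upper_bound by blast
  obtain B2 where B2: "\<And>x. coeff_at g x \<noteq> 0 \<Longrightarrow> x \<le> B2" using ex_upper_bound by blast
  obtain B3 where B3: "\<And>x. coeff_at h x \<noteq> 0 \<Longrightarrow> x \<le> B3" using ex_upper_bound by blast
  obtain B12 where B12: "\<And>x. coeff_at (f * g) x \<noteq> 0 \<Longrightarrow> x \<le> B12" using ex_upper_bound by blast
  obtain B23 where B23: "\<And>x. coeff_at (g * h) x \<noteq> 0 \<Longrightarrow> x \<le> B23" using ex_upper_bound by blast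
  define A where "A = {a. coeff_at f a \<noteq> 0 \<and> min (x - B23) (x - B3 - B2) \<le> a}"
  define C where "C = {c. coeff_at h c \<noteq> 0 \<and> min (x - B12) (x - B1 - B2) \<le> c}"
  have fin: "finite A" "finite C" unfolding A_def C_def by (rule finite_above)+
  have "coeff_at ((f * g) * h) x = (\<Sum>c\<in>C. coeff_at (f * g) (x - c) * coeff_at h c)"
    by (rule coeff_at_mult_right[OF fin(2)]) (use B12 in \<open>force simp: C_def\<close>)
  also have "\<dots> = (\<Sum>c\<in>C. (\<Sum>a\<in>A. coeff_at f a * coeff_at g (x - c - a)) * coeff_at h c)"
  proof (rule sum.cong[OF refl])
    fix c assume c: "c \<in> C"
    have "coeff_at (f * g) (x - c) = (\<Sum>a\<in>A. coeff_at f a * coeff_at g (x - c - a))"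
    proof (rule coeff_at_mult_left[OF fin(1)])
      fix y assume y: "coeff_at f y \<noteq> 0" "coeff_at g (x - c - y) \<noteq> 0"
      have "c \<le> B3" using c B3 by (simp add: C_def)
      with B2[OF y(2)] y(1) show "y \<in> A" by (auto simp: A_def min_def)
    qed
    then show "coeff_at (f * g) (x - c) * coeff_at h c =
      (\<Sum>a\<in>A. coeff_at f a * coeff_at g (x - c - a)) * coeff_at h c" by simp
  qed
  also have "\<dots> = (\<Sum>a\<in>A. \<Sum>c\<in>C. coeff_at f a * coeff_at g (x - c - a) * coeff_at h c)"
    by (simp add: sum_distrib_right) (rule sum.swap)
  also have "\<dots> = (\<Sum>a\<in>A. coeff_at f a * (\<Sum>c\<in>C. coeff_at g (x - a - c) * coeff_at h c))"
    by (simp add: sum_distrib_left mult.assoc algebra_simps)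
  also have "\<dots> = (\<Sum>a\<in>A. coeff_at f a * coeff_at (g * h) (x - a))"
  proof (rule sum.cong[OF refl])
    fix a assume a: "a \<in> A"
    have "coeff_at (g * h) (x - a) = (\<Sum>c\<in>C. coeff_at g (x - a - c) * coeff_at h c)"
    proof (rule coeff_at_mult_right[OF fin(2)])
      fix y assume y: "coeff_at g (x - a - y) \<noteq> 0" "coeff_at h y \<noteq> 0"
      have "a \<le> B1" using a B1 by (simp add: A_def)
      with B2[OF y(1)] y(2) show "y \<in> C" by (auto simp: C_def min_def)
    qed
    then show "coeff_at f a * (\<Sum>c\<in>C. coeff_at g (x - a - c) * coeff_at h c) =
      coeff_at f a * coeff_at (g * h) (x - a)" by simp
  qed
  also have "\<dots> = coeff_at (f * (g * h)) x"
    by (rule coeff_at_mult_left[OF fin(1), symmetric]) (use B23 in \<open>force simp: A_def\<close>)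
  finally show "coeff_at ((f * g) * h) x = coeff_at (f * (g * h)) x" .
qed

instance
proof
  fix f g h :: puiseux
  show "f * g * h = f * (g * h)" by (rule puiseux_mult_assoc)
  show "f * g = g * f" by (rule puiseux_mult_commute)
  show "1 * f = f"
  proof (rule puiseux_eqI)
    fix x
    show "coeff_at (1 * f) x = coeff_at f x"
      by (subst coeff_at_mult_left[of "{0}"]) (auto simp: coeff_at_one split: if_splits)
  qed
  show "(f + g) * h = f * h + g * h"
  proof (rule puiseux_eqI)
    fix x
    let ?A = "{y. coeff_at f y \<noteq> 0 \<and> coeff_at h (x - y) \<noteq> 0} \<union> {y. coeff_at g y \<noteq> 0 \<and> coeff_at h (x - y) \<noteq> 0}"
    have A: "finite ?A" by (simp add: finite_convolution)
    have "coeff_at ((f + g) * h) x = (\<Sum>y\<in>?A. coeff_at (f + g) y * coeff_at h (x - y))"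
      by (rule coeff_at_mult_left[OF A]) auto
    also have "\<dots> = (\<Sum>y\<in>?A. coeff_at f y * coeff_at h (x - y)) + (\<Sum>y\<in>?A. coeff_at g y * coeff_at h (x - y))"
      by (simp add: distrib_right sum.distrib)
    also have "(\<Sum>y\<in>?A. coeff_at f y * coeff_at h (x - y)) = coeff_at (f * h) x"
      by (rule coeff_at_mult_left[OF A, symmetric]) auto
    also have "(\<Sum>y\<in>?A. coeff_at g y * coeff_at h (x - y)) = coeff_at (g * h) x"
      by (rule coeff_at_mult_left[OF A, symmetric]) auto
    finally show "coeff_at ((f + g) * h) x = coeff_at (f * h + g * h) x" by simp
  qed
  have "coeff_at 0 0 \<noteq> coeff_at 1 0" by (simp add: coeff_at_one)
  then show "(0 :: puiseux) \<noteq> 1" by metis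
qed (auto intro!: puiseux_eqI simp: minus_puiseux_def)

end

subsection \<open>Leading exponent\<close>

definition lead_exp :: "puiseux \<Rightarrow> real" where
  "lead_exp f = (GREATEST x. coeff_at f x \<noteq> 0)"

lemma
  assumes "f \<noteq> 0"
  shows coeff_at_lead_exp: "coeff_at f (lead_exp f) \<noteq> 0"
    and lead_exp_ge: "coeff_at f x \<noteq> 0 \<Longrightarrow> x \<le> lead_exp f"
proof -
  obtain x0 where x0: "coeff_at f x0 \<noteq> 0"
    using assms puiseux_eqI[of f 0] by auto
  let ?T = "{x. coeff_at f x \<noteq> 0 \<and> x0 \<le> x}"
  have T: "finite ?T" "x0 \<in> ?T" using finite_above x0 by auto
  have max: "coeff_at f y \<noteq> 0 \<Longrightarrow> y \<le> Max ?T" for y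
    using Max_ge[OF T(1), of y] Max_ge[OF T] by fastforce
  have in_T: "Max ?T \<in> ?T" using T Max_in by blast
  have "lead_exp f = Max ?T"
    unfolding lead_exp_def by (rule Greatest_equality) (use max in_T in auto)
  then show "coeff_at f (lead_exp f) \<noteq> 0" "coeff_at f x \<noteq> 0 \<Longrightarrow> x \<le> lead_exp f"
    using max in_T by auto
qed

lemma lead_exp_eqI:
  assumes "coeff_at f a \<noteq> 0" "\<And>x. coeff_at f x \<noteq> 0 \<Longrightarrow> x \<le> a"
  shows "lead_exp f = a"
  unfolding lead_exp_def by (rule Greatest_equality) (use assms in auto)

lemma coeff_at_eq_0: "lead_exp f < x \<Longrightarrow> coeff_at f x = 0"
  using lead_exp_ge[of f x] by (cases "f = 0") auto

lemma coeff_at_mult_lead: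
  assumes "\<And>x. coeff_at f x \<noteq> 0 \<Longrightarrow> x \<le> a" "\<And>x. coeff_at g x \<noteq> 0 \<Longrightarrow> x \<le> b"
  shows "coeff_at (f * g) (a + b) = coeff_at f a * coeff_at g b"
    and "coeff_at (f * g) x \<noteq> 0 \<Longrightarrow> x \<le> a + b"
proof -
  have "y = a" if "coeff_at f y \<noteq> 0" "coeff_at g (a + b - y) \<noteq> 0" for y
    using assms(1)[OF that(1)] assms(2)[OF that(2)] by linarith
  then show "coeff_at (f * g) (a + b) = coeff_at f a * coeff_at g b"
    by (subst coeff_at_mult_left[of "{a}"]) auto
  assume "coeff_at (f * g) x \<noteq> 0"
  then obtain y where y: "coeff_at f y \<noteq> 0" "coeff_at g (x - y) \<noteq> 0"
    unfolding coeff_at_mult by (rule convolution_nonzeroE)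
  show "x \<le> a + b" using assms(1)[OF y(1)] assms(2)[OF y(2)] by linarith
qed

lemma
  assumes "f \<noteq> 0" "g \<noteq> 0"
  shows lead_exp_mult: "lead_exp (f * g) = lead_exp f + lead_exp g"
    and lead_coeff_mult:
      "coeff_at (f * g) (lead_exp (f * g)) = coeff_at f (lead_exp f) * coeff_at g (lead_exp g)"
    and puiseux_mult_nonzero: "f * g \<noteq> 0"
proof -
  have L: "coeff_at (f * g) (lead_exp f + lead_exp g) = coeff_at f (lead_exp f) * coeff_at g (lead_exp g)"
    "coeff_at (f * g) x \<noteq> 0 \<Longrightarrow> x \<le> lead_exp f + lead_exp g" for x
    by (rule coeff_at_mult_lead; use lead_exp_ge assms in blast)+
  have nz: "coeff_at f (lead_exp f) * coeff_at g (lead_exp g) \<noteq> 0"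
    using assms by (simp add: coeff_at_lead_exp)
  show *: "lead_exp (f * g) = lead_exp f + lead_exp g"
    by (rule lead_exp_eqI) (use L nz in auto)
  show "coeff_at (f * g) (lead_exp (f * g)) = coeff_at f (lead_exp f) * coeff_at g (lead_exp g)"
    by (simp add: * L)
  show "f * g \<noteq> 0" using L(1) nz by auto
qed

subsection \<open>Field structure\<close>

lift_definition puiseux_monom :: "real \<Rightarrow> real \<Rightarrow> puiseux" is "\<lambda>a b x. if x = b then a else 0"
  by (simp add: puiseux_support_def)

lemma coeff_at_monom: "coeff_at (puiseux_monom a b) x = (if x = b then a else 0)"
  by transfer simp

lemma puiseux_monom_mult: "puiseux_monom a b * puiseux_monom c d = puiseux_monom (a * c) (b + d)"
proof (rule puiseux_eqI)
  fix x
  show "coeff_at (puiseux_monom a b * puiseux_monom c d) x = coeff_at (puiseux_monom (a * c) (b + d)) x"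
    by (subst coeff_at_mult_left[of "{b}"]) (auto simp: coeff_at_monom split: if_splits)
qed

lemma puiseux_monom_1: "puiseux_monom 1 0 = 1"
  by (rule puiseux_eqI) (simp add: coeff_at_monom coeff_at_one)

lemma coeff_at_sum: "coeff_at (sum f A) x = (\<Sum>i\<in>A. coeff_at (f i) x)"
  by (induction A rule: infinite_finite_induct) auto

lemma geometric_inverse:
  assumes b: "b < 0" and h: "\<And>x. coeff_at h x \<noteq> 0 \<Longrightarrow> x \<le> b"
  shows "\<exists>g. (1 - h) * g = 1"
proof -
  have pow: "x \<le> real n * b" if "coeff_at (h ^ n) x \<noteq> 0" for n x
    using that
  proof (induction n arbitrary: x)
    case 0
    then show ?case by (auto simp: coeff_at_one split: if_splits)
  next
    case (Suc n)
    then show ?case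
      using coeff_at_mult_lead(2)[of h b "h ^ n" "real n * b" x] h by (simp add: algebra_simps)
  qed
  define S where "S N = (\<Sum>n<N. h ^ n)" for N
  define M where "M x = nat \<lceil>x / b\<rceil> + 1" for x :: real
  have zero: "coeff_at (h ^ n) x = 0" if "M x \<le> n" for n x
  proof (rule ccontr)
    assume "coeff_at (h ^ n) x \<noteq> 0"
    then have "x \<le> real n * b" by (rule pow)
    then have "real n \<le> x / b" using b by (simp add: field_simps)
    then show False using that unfolding M_def by linarith
  qed
  have stable: "coeff_at (S N) x = coeff_at (S (M x)) x" if "M x \<le> N" for N x
    unfolding S_def coeff_at_sum using that zero
    by (intro sum.mono_neutral_right) auto
  have mono: "M y \<le> M x" if "x \<le> y" for x y
  proof -
    have "y / b \<le> x / b" using that b by (simp add: divide_right_mono_neg)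
    then show ?thesis unfolding M_def by (intro add_right_mono nat_mono ceiling_mono)
  qed
  define g where "g = Abs_puiseux (\<lambda>x. coeff_at (S (M x)) x)"
  have "finite {x. coeff_at (S (M x)) x \<noteq> 0 \<and> c \<le> x}" for c
  proof (rule finite_subset)
    show "{x. coeff_at (S (M x)) x \<noteq> 0 \<and> c \<le> x} \<subseteq> {x. coeff_at (S (M c)) x \<noteq> 0 \<and> c \<le> x}"
    proof clarify
      fix x assume nz: "coeff_at (S (M x)) x \<noteq> 0" and "c \<le> x" and z: "coeff_at (S (M c)) x = 0"
      from stable[OF mono[OF \<open>c \<le> x\<close>]] nz z show False by metis
    qed
  qed (rule finite_above)
  then have g: "coeff_at g x = coeff_at (S (M x)) x" for x
    unfolding g_def by (subst Abs_puiseux_inverse) (auto simp: puiseux_support_iff)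
  have "(1 - h) * g = 1"
  proof (rule puiseux_eqI)
    fix x
    let ?S = "S (M x)"
    have le: "y \<le> 0" if "coeff_at (1 - h) y \<noteq> 0" for y
      using that h[of y] b by (cases "y = 0") (auto simp: coeff_at_one)
    have eq: "coeff_at (1 - h) y * coeff_at g (x - y) = coeff_at (1 - h) y * coeff_at ?S (x - y)" for y
    proof (cases "coeff_at (1 - h) y = 0")
      case False
      then have "x \<le> x - y" using le[of y] by linarith
      from stable[OF mono[OF this]] show ?thesis by (simp only: g)
    qed simp
    let ?A = "{y. coeff_at (1 - h) y \<noteq> 0 \<and> coeff_at g (x - y) \<noteq> 0} \<union>
              {y. coeff_at (1 - h) y \<noteq> 0 \<and> coeff_at ?S (x - y) \<noteq> 0}"
    have A: "finite ?A" using finite_convolution by blast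
    have "coeff_at ((1 - h) * g) x = (\<Sum>y\<in>?A. coeff_at (1 - h) y * coeff_at g (x - y))"
      by (rule coeff_at_mult_left[OF A]) auto
    also have "\<dots> = (\<Sum>y\<in>?A. coeff_at (1 - h) y * coeff_at ?S (x - y))"
      by (simp only: eq)
    also have "\<dots> = coeff_at ((1 - h) * ?S) x"
      by (rule coeff_at_mult_left[OF A, symmetric]) auto
    also have "(1 - h) * ?S = 1 - h ^ M x"
      unfolding S_def by (rule one_diff_power_eq[symmetric])
    also have "coeff_at (1 - h ^ M x) x = coeff_at 1 x"
      using zero[of x "M x"] by simp
    finally show "coeff_at ((1 - h) * g) x = coeff_at 1 x" .
  qed
  then show ?thesis ..
qed

lemma puiseux_ex_inverse:
  fixes f :: puiseux
  assumes "f \<noteq> 0"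
  shows "\<exists>g. f * g = 1"
proof -
  let ?d = "lead_exp f" and ?c = "coeff_at f (lead_exp f)"
  define m where "m = puiseux_monom (1 / ?c) (- ?d)"
  have c: "?c \<noteq> 0" using assms by (rule coeff_at_lead_exp)
  define h where "h = 1 - m * f"
  have mx: "coeff_at (m * f) x = coeff_at f (x + ?d) / ?c" for x
    unfolding m_def
    by (subst coeff_at_mult_left[of "{- ?d}"]) (auto simp: coeff_at_monom split: if_splits)
  have neg: "x < 0" if "coeff_at h x \<noteq> 0" for x
  proof (rule ccontr)
    assume "\<not> x < 0"
    then have "coeff_at h x = 0" using c coeff_at_eq_0[of f "x + ?d"]
      by (cases "x = 0") (auto simp: h_def mx coeff_at_one)
    with that show False by simp
  qed
  have "\<exists>b<0. \<forall>x. coeff_at h x \<noteq> 0 \<longrightarrow> x \<le> b"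
  proof (cases "h = 0")
    case True
    then show ?thesis by (intro exI[of _ "-1"]) auto
  next
    case False
    then show ?thesis using neg coeff_at_lead_exp lead_exp_ge by blast
  qed
  then obtain g where "(1 - h) * g = 1" using geometric_inverse by blast
  then have "f * (m * g) = 1" by (simp add: h_def ac_simps)
  then show ?thesis ..
qed

instantiation puiseux :: field
begin

definition inverse_puiseux :: "puiseux \<Rightarrow> puiseux" where
  "inverse_puiseux f = (if f = 0 then 0 else (THE g. f * g = 1))"

definition divide_puiseux :: "puiseux \<Rightarrow> puiseux \<Rightarrow> puiseux" where
  "divide_puiseux f g = f * inverse g"

instance
proof
  fix f :: puiseux
  assume f: "f \<noteq> 0"
  then obtain g where g: "f * g = 1" using puiseux_ex_inverse by blast
  have "g' = g" if "f * g' = 1" for g'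
    using g that by (metis mult.assoc mult.commute mult.right_neutral)
  then have "(THE g. f * g = 1) = g" using g by blast
  then show "inverse f * f = 1" using f g by (simp add: inverse_puiseux_def mult.commute)
qed (simp_all add: divide_puiseux_def inverse_puiseux_def)

end

subsection \<open>Order\<close>

definition puiseux_pos :: "puiseux \<Rightarrow> bool" where
  "puiseux_pos f \<longleftrightarrow> f \<noteq> 0 \<and> coeff_at f (lead_exp f) > 0"

lemma puiseux_pos_mult: "puiseux_pos f \<Longrightarrow> puiseux_pos g \<Longrightarrow> puiseux_pos (f * g)"
  by (simp add: puiseux_pos_def lead_coeff_mult)

lemma lead_exp_uminus: "lead_exp (- f) = lead_exp f"
  by (simp add: lead_exp_def)

lemma puiseux_pos_cases: "f = 0 \<or> puiseux_pos f \<or> puiseux_pos (- f)"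
  using coeff_at_lead_exp[of f] by (auto simp: puiseux_pos_def lead_exp_uminus)

lemma not_puiseux_pos_uminus: "puiseux_pos f \<Longrightarrow> \<not> puiseux_pos (- f)"
  by (simp add: puiseux_pos_def lead_exp_uminus)

lemma puiseux_pos_add:
  assumes "puiseux_pos f" "puiseux_pos g"
  shows "puiseux_pos (f + g)"
proof -
  let ?m = "max (lead_exp f) (lead_exp g)"
  have f: "f \<noteq> 0" "coeff_at f (lead_exp f) > 0" and g: "g \<noteq> 0" "coeff_at g (lead_exp g) > 0"
    using assms by (auto simp: puiseux_pos_def)
  have pos: "coeff_at (f + g) ?m > 0"
    using f g coeff_at_eq_0[of f "lead_exp g"] coeff_at_eq_0[of g "lead_exp f"]
    by (cases "lead_exp f" "lead_exp g" rule: linorder_cases) (auto simp: max_def)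
  have "lead_exp (f + g) = ?m"
  proof (rule lead_exp_eqI)
    fix x assume "coeff_at (f + g) x \<noteq> 0"
    then have "coeff_at f x \<noteq> 0 \<or> coeff_at g x \<noteq> 0" by auto
    then show "x \<le> ?m" using lead_exp_ge[OF f(1)] lead_exp_ge[OF g(1)] by (auto simp: le_max_iff_disj)
  qed (use pos in simp)
  moreover have "f + g \<noteq> 0"
  proof
    assume "f + g = 0"
    with pos show False by (simp del: coeff_at_add)
  qed
  ultimately show ?thesis using pos by (simp add: puiseux_pos_def)
qed

instantiation puiseux :: linordered_field
begin

definition less_puiseux :: "puiseux \<Rightarrow> puiseux \<Rightarrow> bool" where
  "f < g \<longleftrightarrow> puiseux_pos (g - f)"

definition less_eq_puiseux :: "puiseux \<Rightarrow> puiseux \<Rightarrow> bool" where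
  "f \<le> g \<longleftrightarrow> f = g \<or> puiseux_pos (g - f)"

definition abs_puiseux :: "puiseux \<Rightarrow> puiseux" where
  "abs_puiseux f = (if f < 0 then - f else f)"

definition sgn_puiseux :: "puiseux \<Rightarrow> puiseux" where
  "sgn_puiseux f = (if f = 0 then 0 else if 0 < f then 1 else - 1)"

instance
proof
  fix f g h :: puiseux
  have not0: "\<not> puiseux_pos 0" by (simp add: puiseux_pos_def)
  show "(f < g) = (f \<le> g \<and> \<not> g \<le> f)"
    using not_puiseux_pos_uminus[of "g - f"] not0 by (auto simp: less_puiseux_def less_eq_puiseux_def)
  show "f \<le> f" by (simp add: less_eq_puiseux_def)
  show "f \<le> h" if "f \<le> g" "g \<le> h"
    using that puiseux_pos_add[of "g - f" "h - g"] by (auto simp: less_eq_puiseux_def)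
  show "f = g" if "f \<le> g" "g \<le> f"
    using that not_puiseux_pos_uminus[of "g - f"] by (auto simp: less_eq_puiseux_def)
  show "f \<le> g \<or> g \<le> f"
    using puiseux_pos_cases[of "g - f"] by (auto simp: less_eq_puiseux_def)
  show "h + f \<le> h + g" if "f \<le> g"
    using that by (auto simp: less_eq_puiseux_def)
  show "h * f < h * g" if "f < g" "0 < h"
    using that puiseux_pos_mult[of h "g - f"] by (simp add: less_puiseux_def algebra_simps)
  show "\<bar>f\<bar> = (if f < 0 then - f else f)" by (rule abs_puiseux_def)
  show "sgn f = (if f = 0 then 0 else if 0 < f then 1 else - 1)" by (rule sgn_puiseux_def)
qed

end

section \<open>The tropical semifield\<close>

datatype tropical = NegInf | Fin real

instantiation tropical :: linorder
begin

fun less_eq_tropical :: "tropical \<Rightarrow> tropical \<Rightarrow> bool" where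
  "NegInf \<le> b \<longleftrightarrow> True"
| "Fin x \<le> NegInf \<longleftrightarrow> False"
| "Fin x \<le> Fin y \<longleftrightarrow> x \<le> y"

definition less_tropical :: "tropical \<Rightarrow> tropical \<Rightarrow> bool" where
  "less_tropical a b \<longleftrightarrow> a \<le> b \<and> \<not> b \<le> a"

instance
proof
  fix a b c :: tropical
  show "(a < b) = (a \<le> b \<and> \<not> b \<le> a)" by (rule less_tropical_def)
  show "a \<le> a" by (cases a) auto
  show "a \<le> c" if "a \<le> b" "b \<le> c" using that by (cases a; cases b; cases c) auto
  show "a = b" if "a \<le> b" "b \<le> a" using that by (cases a; cases b) auto
  show "a \<le> b \<or> b \<le> a" by (cases a; cases b) auto
qed

end

text \<open>
  The operations \<open>+\<close>, \<open>*\<close>, \<open>0\<close>, \<open>1\<close> on this type are the tropical ones: maximum, addition,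
  \<open>-\<infinity>\<close> and the real number zero. Hence \<open>*\<close> on matrices over this type is the tropical matrix
  product and \<open>1\<^sub>m n\<close> is the tropical identity matrix.
\<close>

instantiation tropical :: comm_semiring_1
begin

definition zero_tropical :: tropical where
  "zero_tropical = NegInf"

definition one_tropical :: tropical where
  "one_tropical = Fin 0"

definition plus_tropical :: "tropical \<Rightarrow> tropical \<Rightarrow> tropical" where
  "plus_tropical a b = max a b"

fun times_tropical :: "tropical \<Rightarrow> tropical \<Rightarrow> tropical" where
  "Fin x * Fin y = Fin (x + y)"
| "NegInf * b = NegInf"
| "a * NegInf = NegInf"

instance
proof
  fix a b c :: tropical
  show "a * b * c = a * (b * c)" by (cases a; cases b; cases c) auto
  show "a * b = b * a" by (cases a; cases b) auto
  show "1 * a = a" by (cases a) (auto simp: one_tropical_def)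
  show "a + b + c = a + (b + c)" by (simp add: plus_tropical_def max.assoc)
  show "a + b = b + a" by (simp add: plus_tropical_def max.commute)
  show "0 + a = a" by (cases a) (auto simp: plus_tropical_def zero_tropical_def max_def)
  show "(a + b) * c = a * c + b * c"
    by (cases a; cases b; cases c) (auto simp: plus_tropical_def max_def)
  show "0 * a = 0" by (simp add: zero_tropical_def)
  show "a * 0 = 0" by (cases a) (auto simp: zero_tropical_def)
  show "(0 :: tropical) \<noteq> 1" by (simp add: zero_tropical_def one_tropical_def)
qed

end

definition val :: "puiseux \<Rightarrow> tropical" where
  "val f = (if f = 0 then NegInf else Fin (lead_exp f))"

section \<open>Matrices\<close>

definition GL :: "nat \<Rightarrow> puiseux mat set" where
  "GL n = {A \<in> carrier_mat n n. invertible_mat A}"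

text \<open>The empty minor equals 1, so allowing empty index sets imposes no further condition.\<close>

definition TN :: "puiseux mat set" where
  "TN = {A. \<forall>I \<subseteq> {..<dim_row A}. \<forall>J \<subseteq> {..<dim_col A}.
              card I = card J \<longrightarrow> 0 \<le> det (submatrix A I J)}"

definition tropical_jacobi :: "nat \<Rightarrow> tropical mat set" where
  "tropical_jacobi n = {A \<in> carrier_mat n n.
     let D = {(i, j). i < n \<and> j < n \<and> A $$ (i, j) \<noteq> 1\<^sub>m n $$ (i, j)}
     in card D \<le> 1 \<and>
        (\<forall>(i, j) \<in> D. A $$ (i, j) \<noteq> NegInf \<and> (i = j \<or> i = Suc j \<or> j = Suc i))}"

inductive_set mult_semigroup :: "'a :: times set \<Rightarrow> 'a set" for S where
  generator: "A \<in> S \<Longrightarrow> A \<in> mult_semigroup S"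
| mult: "A \<in> mult_semigroup S \<Longrightarrow> B \<in> mult_semigroup S \<Longrightarrow> A * B \<in> mult_semigroup S"

end

theory Submission
  imports Defs
begin

text \<open>
  The valuation turns products of matrices with nonnegative entries into tropical products, since
  leading terms of nonnegative series never cancel (\<open>val_mat_mult\<close>). It therefore suffices to know
  that the invertible totally nonnegative matrices are exactly the products of positive Jacobi
  matrices, that is, identity matrices changed by a positive factor on the diagonal or a positive
  entry next to it: the entrywise valuations of these generators are precisely the tropical Jacobi
  matrices (\<open>val_pos_jacobi\<close>). That factorization is the theorem of Whitney and Loewner, proved here
  over every linearly ordered field (\<open>totally_nonneg_invertible_iff_semigroup\<close>).

  A positive Jacobi factor on the left scales one row, or adds a positive multiple of a row to a
  neighbouring row. Expanding a minor along the modified row gives the old minor plus a nonnegative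
  multiple of another minor of the same matrix: because the two rows are neighbours, exchanging them
  keeps the chosen rows in order. So products of positive Jacobi matrices are totally nonnegative.

  Conversely, a matrix is reduced to diagonal form by subtracting multiples of neighbouring rows
  (Neville elimination). It is delicate to show directly that such a step preserves nonnegativity of
  every minor, because of minors that use rows on both sides of the pivot row but not the pivot row
  itself. The way around this is to carry along only the minors with consecutive rows (and arbitrary
  columns). Such a minor of the new matrix either agrees with the old one, or its first row is the
  modified row; in the latter case it has a zero column, or bordering it by the pivot row and the
  pivot column exhibits it as an old minor with consecutive rows, divided by the pivot (\<open>row_consecutive_nonneg_eliminate\<close>). This
  weaker property is also all that is needed to see that pivots do not vanish (\<open>pivot_positive\<close>).
  Eliminating below the diagonal leaves an upper triangular matrix. A half turn of the matrix, which
  preserves the property, the determinant and the set of generators, makes it lower triangular, and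
  a second elimination then leaves a diagonal matrix.
\<close>

section \<open>Determinants\<close>

lemma det_zero_column:
  fixes A :: "'a::comm_ring_1 mat"
  assumes "A \<in> carrier_mat n n" "j < n" "\<And>i. i < n \<Longrightarrow> A $$ (i, j) = 0"
  shows "det A = 0"
  using laplace_expansion_column[OF assms(1,2)] assms(3) by simp

lemma det_zero_row:
  fixes A :: "'a::comm_ring_1 mat"
  assumes "A \<in> carrier_mat n n" "i < n" "\<And>j. j < n \<Longrightarrow> A $$ (i, j) = 0"
  shows "det A = 0"
  using laplace_expansion_row[OF assms(1,2)] assms(3) by simp

lemma det_pivot_column:
  fixes A :: "'a::comm_ring_1 mat"
  assumes A: "A \<in> carrier_mat (Suc m) (Suc m)"
    and zero: "\<And>i. 0 < i \<Longrightarrow> i \<le> m \<Longrightarrow> A $$ (i, 0) = 0"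
  shows "det A = A $$ (0, 0) * det (mat_delete A 0 0)"
proof -
  have "det A = (\<Sum>i<Suc m. A $$ (i, 0) * cofactor A i 0)"
    by (rule laplace_expansion_column[OF A]) simp
  also have "\<dots> = A $$ (0, 0) * cofactor A 0 0"
    by (subst sum.lessThan_Suc_shift) (simp add: zero)
  finally show ?thesis by (simp add: cofactor_def)
qed

lemma det_row_linear:
  fixes P :: "'a::comm_ring_1 mat"
  assumes P: "P \<in> carrier_mat m m" and Q: "Q \<in> carrier_mat m m" and R: "R \<in> carrier_mat m m"
    and i: "i < m"
    and row_i: "\<And>l. l < m \<Longrightarrow> P $$ (i, l) = Q $$ (i, l) + c * R $$ (i, l)"
    and other: "\<And>i' l. i' < m \<Longrightarrow> i' \<noteq> i \<Longrightarrow> l < m \<Longrightarrow> Q $$ (i', l) = P $$ (i', l) \<and> R $$ (i', l) = P $$ (i', l)"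
  shows "det P = det Q + c * det R"
proof -
  have del: "mat_delete Q i l = mat_delete P i l" "mat_delete R i l = mat_delete P i l" if "l < m" for l
    using P Q R i other that unfolding mat_delete_def by (auto intro!: eq_matI)
  have cof: "cofactor Q i l = cofactor P i l" "cofactor R i l = cofactor P i l" if "l < m" for l
    using del[OF that] by (simp_all add: cofactor_def)
  have "det P = (\<Sum>l<m. P $$ (i, l) * cofactor P i l)"
    by (rule laplace_expansion_row[OF P i])
  also have "\<dots> = (\<Sum>l<m. Q $$ (i, l) * cofactor Q i l + c * (R $$ (i, l) * cofactor R i l))"
    by (intro sum.cong refl) (simp add: row_i cof algebra_simps)
  also have "\<dots> = det Q + c * det R"
    by (simp add: sum.distrib sum_distrib_left laplace_expansion_row[OF Q i] laplace_expansion_row[OF R i])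
  finally show ?thesis .
qed

lemma invertible_mat_iff_det:
  fixes A :: "'a::field mat"
  assumes A: "A \<in> carrier_mat n n"
  shows "invertible_mat A \<longleftrightarrow> det A \<noteq> 0"
proof
  assume "invertible_mat A"
  then obtain B where AB: "A * B = 1\<^sub>m n" and BA: "B * A = 1\<^sub>m (dim_row B)"
    using A by (auto simp: invertible_mat_def inverts_mat_def)
  have "dim_col (A * B) = n" "dim_col (B * A) = dim_row B"
    unfolding AB BA by simp_all
  then have B: "B \<in> carrier_mat n n" using A by (auto intro: carrier_matI)
  show "det A \<noteq> 0"
    using det_mult[OF A B] AB by auto
next
  assume "det A \<noteq> 0"
  from det_non_zero_imp_unit[OF A this, of undefined]
  obtain B where B: "B \<in> carrier_mat n n" "A * B = 1\<^sub>m n" "B * A = 1\<^sub>m n"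
    by (auto simp: Units_def ring_mat_def)
  then show "invertible_mat A"
    using A unfolding invertible_mat_def inverts_mat_def by auto
qed

section \<open>Minors indexed by increasing maps\<close>

text \<open>
  Rows and columns of a minor are listed by strictly increasing maps on an initial segment of the
  naturals rather than given as sets. Modifying, extending and reversing a choice of rows or columns
  then is an operation on functions.
\<close>
definition index_map :: "nat \<Rightarrow> nat \<Rightarrow> (nat \<Rightarrow> nat) \<Rightarrow> bool" where
  "index_map m n f \<longleftrightarrow> strict_mono_on {..<m} f \<and> (\<forall>i<m. f i < n)"

definition minor_mat :: "'a mat \<Rightarrow> nat \<Rightarrow> (nat \<Rightarrow> nat) \<Rightarrow> (nat \<Rightarrow> nat) \<Rightarrow> 'a mat" where
  "minor_mat A m g f = mat m m (\<lambda>(i, l). A $$ (g i, f l))"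

definition totally_nonneg :: "'a::linordered_field mat \<Rightarrow> bool" where
  "totally_nonneg A \<longleftrightarrow>
    (\<forall>m g f. index_map m (dim_row A) g \<longrightarrow> index_map m (dim_col A) f \<longrightarrow> 0 \<le> det (minor_mat A m g f))"

text \<open>
  The invariant of the elimination: only minors whose rows are consecutive are constrained.
\<close>
definition row_consecutive_nonneg :: "'a::linordered_field mat \<Rightarrow> bool" where
  "row_consecutive_nonneg A \<longleftrightarrow>
    (\<forall>m r f. r + m \<le> dim_row A \<longrightarrow> index_map m (dim_col A) f \<longrightarrow> 0 \<le> det (minor_mat A m ((+) r) f))"

lemma minor_mat_carrier [simp]: "minor_mat A m g f \<in> carrier_mat m m"
  and minor_mat_dim [simp]: "dim_row (minor_mat A m g f) = m" "dim_col (minor_mat A m g f) = m"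
  and minor_mat_index [simp]: "i < m \<Longrightarrow> l < m \<Longrightarrow> minor_mat A m g f $$ (i, l) = A $$ (g i, f l)"
  by (simp_all add: minor_mat_def)

lemma index_mapD:
  assumes "index_map m n f"
  shows "i < l \<Longrightarrow> l < m \<Longrightarrow> f i < f l" and "i < m \<Longrightarrow> f i < n"
  using assms by (auto simp: index_map_def strict_mono_on_def)

lemma index_map_eq_iff:
  assumes "index_map m n f" "i < m" "l < m"
  shows "f i = f l \<longleftrightarrow> i = l"
  using index_mapD(1)[OF assms(1), of i l] index_mapD(1)[OF assms(1), of l i] assms
  by (cases i l rule: linorder_cases) auto

lemma submatrix_image:
  assumes g: "index_map m (dim_row A) g" and f: "index_map m (dim_col A) f"
  shows "submatrix A (g ` {..<m}) (f ` {..<m}) = minor_mat A m g f"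
proof -
  have dim: "card {i. i < n \<and> i \<in> h ` {..<m}} = m" if "index_map m n h" for n h
  proof -
    have "{i. i < n \<and> i \<in> h ` {..<m}} = h ` {..<m}" using index_mapD(2)[OF that] by auto
    moreover have "inj_on h {..<m}" using index_map_eq_iff[OF that] by (auto simp: inj_on_def)
    ultimately show ?thesis by (simp add: card_image)
  qed
  have pick: "pick (h ` {..<m}) i = h i" if h: "index_map m n h" and i: "i < m" for n h i
  proof -
    have "a < i \<longleftrightarrow> h a < h i" if "a < m" for a
      using index_mapD(1)[OF h, of a i] index_mapD(1)[OF h, of i a] i that
      by (cases a i rule: linorder_cases) auto
    then have "{a \<in> h ` {..<m}. a < h i} = h ` {a \<in> {..<m}. a < i}" by auto
    also have "{a \<in> {..<m}. a < i} = {..<i}" using i by auto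
    finally have "{a \<in> h ` {..<m}. a < h i} = h ` {..<i}" .
    moreover have "inj_on h {..<i}" using index_map_eq_iff[OF h] i by (auto simp: inj_on_def)
    ultimately have "card {a \<in> h ` {..<m}. a < h i} = i" by (simp add: card_image)
    then show ?thesis using pick_card_in_set[of "h i" "h ` {..<m}"] i by simp
  qed
  show ?thesis
    unfolding submatrix_def dim[OF g] dim[OF f]
    by (rule eq_matI) (auto simp: pick[OF g] pick[OF f])
qed

lemma index_map_pick:
  assumes "I \<subseteq> {..<n}"
  shows "index_map (card I) n (pick I)"
  using assms pick_mono[of _ I] pick_in_set[of _ I] unfolding index_map_def strict_mono_on_def by auto

lemma TN_iff_totally_nonneg: "A \<in> TN \<longleftrightarrow> totally_nonneg A"
proof
  assume A: "A \<in> TN"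
  show "totally_nonneg A"
    unfolding totally_nonneg_def
  proof (intro allI impI)
    fix m g f
    assume g: "index_map m (dim_row A) g" and f: "index_map m (dim_col A) f"
    have "card (h ` {..<m}) = m" if "index_map m n h" for n h
      using index_map_eq_iff[OF that] by (subst card_image) (auto simp: inj_on_def)
    with g f have "card (g ` {..<m}) = card (f ` {..<m})" by metis
    moreover have "g ` {..<m} \<subseteq> {..<dim_row A}" "f ` {..<m} \<subseteq> {..<dim_col A}"
      using index_mapD(2)[OF g] index_mapD(2)[OF f] by auto
    ultimately have "0 \<le> det (submatrix A (g ` {..<m}) (f ` {..<m}))"
      using A unfolding TN_def by blast
    then show "0 \<le> det (minor_mat A m g f)" by (simp add: submatrix_image[OF g f])
  qed
next
  assume A: "totally_nonneg A"
  have "0 \<le> det (submatrix A I J)"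
    if I: "I \<subseteq> {..<dim_row A}" and J: "J \<subseteq> {..<dim_col A}" and c: "card I = card J" for I J
  proof -
    have "{i. i < dim_row A \<and> i \<in> I} = I" "{j. j < dim_col A \<and> j \<in> J} = J" using I J by auto
    then have "submatrix A I J = minor_mat A (card I) (pick I) (pick J)"
      unfolding submatrix_def minor_mat_def using c by simp
    then show ?thesis
      using A index_map_pick[OF I] index_map_pick[OF J] c unfolding totally_nonneg_def by simp
  qed
  then show "A \<in> TN" by (simp add: TN_def)
qed

lemma totally_nonneg_imp_row_consecutive:
  assumes "totally_nonneg A"
  shows "row_consecutive_nonneg A"
  using assms unfolding totally_nonneg_def row_consecutive_nonneg_def
  by (auto simp: index_map_def strict_mono_on_def)

lemma row_consecutive_nonneg_entry:
  assumes A: "row_consecutive_nonneg A" and ij: "i < dim_row A" "j < dim_col A"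
  shows "0 \<le> A $$ (i, j)"
proof -
  have "index_map 1 (dim_col A) (\<lambda>_. j)"
    using ij by (auto simp: index_map_def strict_mono_on_def)
  moreover have "i + 1 \<le> dim_row A" using ij by simp
  ultimately have "0 \<le> det (minor_mat A 1 ((+) i) (\<lambda>_. j))"
    using A unfolding row_consecutive_nonneg_def by blast
  then show ?thesis by (subst (asm) det_single) auto
qed

lemma row_consecutive_nonneg_minor2:
  assumes A: "row_consecutive_nonneg A" and i: "Suc i < dim_row A" and jl: "j < l" "l < dim_col A"
  shows "A $$ (Suc i, j) * A $$ (i, l) \<le> A $$ (i, j) * A $$ (Suc i, l)"
proof -
  let ?f = "\<lambda>a. if a = 0 then j else l"
  have "index_map 2 (dim_col A) ?f"
    using jl by (auto simp: index_map_def strict_mono_on_def)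
  then have "0 \<le> det (minor_mat A 2 ((+) i) ?f)"
    using A i unfolding row_consecutive_nonneg_def by auto
  also have "det (minor_mat A 2 ((+) i) ?f) =
      (\<Sum>a<2. minor_mat A 2 ((+) i) ?f $$ (a, 0) * cofactor (minor_mat A 2 ((+) i) ?f) a 0)"
    by (rule laplace_expansion_column) auto
  also have "\<dots> = A $$ (i, j) * A $$ (Suc i, l) - A $$ (Suc i, j) * A $$ (i, l)"
    by (simp add: numeral_2_eq_2 cofactor_def det_single[of "mat 1 1 _", simplified] mat_delete_def)
  finally show ?thesis by simp
qed

section \<open>Elimination by adjacent rows\<close>

text \<open>
  The step of Neville elimination. A minor that contains both rows involved, or not the modified row
  \<open>Suc p\<close>, keeps its value, so only minors starting at row \<open>Suc p\<close> matter. If such a minor uses a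
  column up to the pivot column \<open>j\<close>, it has a zero column. Otherwise adjoining row \<open>p\<close> and column \<open>j\<close>
  gives a larger minor of \<open>A\<close>, with the same value in \<open>A'\<close>, whose first column is zero apart from the
  pivot; so it is the pivot times the minor in question.
\<close>
lemma row_consecutive_nonneg_eliminate:
  fixes A :: "'a::linordered_field mat"
  assumes A: "A \<in> carrier_mat n n" "row_consecutive_nonneg A"
    and p: "Suc p < n" and jp: "j \<le> p" and pivot: "0 < A $$ (p, j)"
    and A': "A' = addrow c (Suc p) p A"
    and zero: "\<And>i l. Suc p \<le> i \<Longrightarrow> i < n \<Longrightarrow> l \<le> j \<Longrightarrow> A' $$ (i, l) = 0"
  shows "row_consecutive_nonneg A'"
  unfolding row_consecutive_nonneg_def
proof (intro allI impI)
  fix m r f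
  assume r: "r + m \<le> dim_row A'" and f: "index_map m (dim_col A') f"
  have dim: "dim_row A' = n" "dim_col A' = n" using A by (simp_all add: A')
  note r = r[unfolded dim] and f = f[unfolded dim]
  have fn: "f l < n" if "l < m" for l using index_mapD(2)[OF f that] .
  have A'_index: "A' $$ (i, l) = (if i = Suc p then c * A $$ (p, l) + A $$ (Suc p, l) else A $$ (i, l))"
    if "i < n" "l < n" for i l
    using A that by (auto simp: A')
  have nonneg: "0 \<le> det (minor_mat A m' ((+) r') f')" if "r' + m' \<le> n" "index_map m' n f'" for m' r' f'
    using A that unfolding row_consecutive_nonneg_def by auto
  consider (outside) "\<not> (r \<le> Suc p \<and> Suc p < r + m)" | (both) "r \<le> p" "Suc p < r + m" | (first) "r = Suc p" "0 < m"
    by linarith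
  then show "0 \<le> det (minor_mat A' m ((+) r) f)"
  proof cases
    case outside
    then have "minor_mat A' m ((+) r) f = minor_mat A m ((+) r) f"
      using r fn by (intro eq_matI) (auto simp: A'_index)
    then show ?thesis using nonneg[OF r f] by simp
  next
    case both
    then have "minor_mat A' m ((+) r) f = addrow c (Suc p - r) (p - r) (minor_mat A m ((+) r) f)"
      using r fn by (intro eq_matI) (auto simp: A'_index)
    then have "det (minor_mat A' m ((+) r) f) = det (minor_mat A m ((+) r) f)"
      using both by (simp add: det_addrow[of _ m])
    then show ?thesis using nonneg[OF r f] by simp
  next
    case first
    show ?thesis
    proof (cases "\<exists>l<m. f l \<le> j")
      case True
      then obtain l where l: "l < m" "f l \<le> j" by blast
      have "det (minor_mat A' m ((+) r) f) = 0"
        by (rule det_zero_column[OF minor_mat_carrier l(1)]) (use l r first in \<open>simp add: zero\<close>)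
      then show ?thesis by simp
    next
      case False
      \<comment> \<open>All chosen columns lie to the right of \<open>j\<close>, so \<open>j\<close> can be put in front of them.\<close>
      define f' where "f' l = (case l of 0 \<Rightarrow> j | Suc l' \<Rightarrow> f l')" for l
      have f': "index_map (Suc m) n f'"
        using f False jp p
        by (auto simp: index_map_def strict_mono_on_def f'_def not_le split: nat.splits)
      let ?N = "minor_mat A (Suc m) ((+) p) f'" and ?N' = "minor_mat A' (Suc m) ((+) p) f'"
      have "?N' = addrow c 1 0 ?N"
        using r first index_mapD(2)[OF f'] by (intro eq_matI) (auto simp: A'_index)
      then have "det ?N = det ?N'" by (simp add: det_addrow[of _ "Suc m"])
      also have "det ?N' = ?N' $$ (0, 0) * det (mat_delete ?N' 0 0)"
      proof (rule det_pivot_column[OF minor_mat_carrier])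
        fix i assume "0 < i" "i \<le> m"
        then show "?N' $$ (i, 0) = 0" using r first by (simp add: zero f'_def)
      qed
      also have "mat_delete ?N' 0 0 = minor_mat A' m ((+) r) f"
        using first by (intro eq_matI) (auto simp: mat_delete_def f'_def)
      also have "?N' $$ (0, 0) = A $$ (p, j)"
        using p jp by (simp add: A'_index f'_def)
      finally have "A $$ (p, j) * det (minor_mat A' m ((+) r) f) = det ?N" by simp
      moreover have "0 \<le> det ?N" using nonneg[OF _ f', of p] r first by simp
      ultimately show ?thesis using pivot by (metis zero_le_mult_iff not_less)
    qed
  qed
qed

definition pos_jacobi :: "nat \<Rightarrow> 'a::linordered_field mat set" where
  "pos_jacobi n =
    {addrow_mat n c k l | c k l. 0 < c \<and> k < n \<and> l < n \<and> (k = Suc l \<or> l = Suc k)} \<union>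
    {multrow_mat n k d | k d. 0 < d \<and> k < n}"

lemma pos_jacobi_cases:
  assumes "E \<in> pos_jacobi n"
  obtains (add) c k l where "E = addrow_mat n c k l" "0 < c" "k < n" "l < n" "k = Suc l \<or> l = Suc k"
    | (mult) k d where "E = multrow_mat n k d" "0 < d" "k < n"
  using assms unfolding pos_jacobi_def by blast

lemma addrow_mat_in_semigroup:
  "0 < c \<Longrightarrow> k < n \<Longrightarrow> l < n \<Longrightarrow> k = Suc l \<or> l = Suc k \<Longrightarrow> addrow_mat n c k l \<in> mult_semigroup (pos_jacobi n)"
  by (rule mult_semigroup.generator) (auto simp: pos_jacobi_def)

lemma multrow_mat_in_semigroup:
  "0 < d \<Longrightarrow> k < n \<Longrightarrow> multrow_mat n k d \<in> mult_semigroup (pos_jacobi n)"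
  by (rule mult_semigroup.generator) (auto simp: pos_jacobi_def)

lemma mult_semigroup_carrier:
  assumes "S \<subseteq> carrier_mat n n" "A \<in> mult_semigroup S"
  shows "A \<in> carrier_mat n n"
  using assms(2) by induction (use assms(1) in auto)

lemma pos_jacobi_carrier: "pos_jacobi n \<subseteq> carrier_mat n n"
  by (auto simp: pos_jacobi_def)

lemmas semigroup_carrier = mult_semigroup_carrier[OF pos_jacobi_carrier]

lemma one_mat_in_semigroup:
  assumes "0 < n"
  shows "(1\<^sub>m n :: 'a::linordered_field mat) \<in> mult_semigroup (pos_jacobi n)"
proof -
  have "(1\<^sub>m n :: 'a mat) = multrow_mat n 0 1" by (rule eq_matI) auto
  then show ?thesis using multrow_mat_in_semigroup[of "1 :: 'a" 0 n] assms by simp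
qed

definition consecutive_TN_GL :: "nat \<Rightarrow> 'a::linordered_field mat set" where
  "consecutive_TN_GL n = {A \<in> carrier_mat n n. row_consecutive_nonneg A \<and> det A \<noteq> 0}"

definition lower_tri :: "nat \<Rightarrow> 'a::zero mat \<Rightarrow> bool" where
  "lower_tri n A \<longleftrightarrow> (\<forall>i l. i < l \<longrightarrow> l < n \<longrightarrow> A $$ (i, l) = 0)"

text \<open>
  The state between two stages of the elimination: the columns before \<open>j\<close> vanish below the diagonal.
\<close>
definition cleared :: "nat \<Rightarrow> nat \<Rightarrow> 'a::zero mat \<Rightarrow> bool" where
  "cleared n j A \<longleftrightarrow> (\<forall>i l. l < j \<longrightarrow> l < i \<longrightarrow> i < n \<longrightarrow> A $$ (i, l) = 0)"

text \<open>
  With a vanishing pivot, the two by two minors on rows \<open>p\<close> and \<open>Suc p\<close> would force all of row \<open>p\<close> to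
  vanish, because its entries are nonnegative. This contradicts invertibility.
\<close>
lemma pivot_positive:
  fixes A :: "'a::linordered_field mat"
  assumes A: "A \<in> consecutive_TN_GL n" and cl: "cleared n j A"
    and p: "j \<le> p" "Suc p < n" and nz: "A $$ (Suc p, j) \<noteq> 0"
  shows "0 < A $$ (p, j)"
proof (rule ccontr)
  have Ac: "A \<in> carrier_mat n n" "row_consecutive_nonneg A" "det A \<noteq> 0"
    using A by (auto simp: consecutive_TN_GL_def)
  have nonneg: "0 \<le> A $$ (i, l)" if "i < n" "l < n" for i l
    using row_consecutive_nonneg_entry[OF Ac(2)] Ac(1) that by auto
  assume "\<not> 0 < A $$ (p, j)"
  then have pj: "A $$ (p, j) = 0" using nonneg[of p j] p by simp
  have "A $$ (p, l) = 0" if l: "l < n" for l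
  proof (cases l j rule: linorder_cases)
    case less
    then show ?thesis using cl p by (simp add: cleared_def)
  next
    case equal
    then show ?thesis using pj by simp
  next
    case greater
    then have "A $$ (Suc p, j) * A $$ (p, l) \<le> 0"
      using row_consecutive_nonneg_minor2[OF Ac(2), of p j l] Ac(1) p l pj by simp
    moreover have "0 < A $$ (Suc p, j)" using nz nonneg[of "Suc p" j] p by simp
    ultimately have "A $$ (p, l) \<le> 0" by (simp add: mult_le_0_iff)
    then show ?thesis using nonneg[of p l] p l by simp
  qed
  then have "det A = 0" using det_zero_row[OF Ac(1), of p] p by simp
  with Ac(3) show False by simp
qed

text \<open>
  Column \<open>j\<close> is cleared from the bottom upwards, each entry being removed by means of the row directly
  above it; this order keeps the entries below the current row zero. Preservation of lower
  triangularity is recorded for the second elimination, which starts from a lower triangular matrix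
  and has to end with a diagonal one.
\<close>
lemma eliminate_column:
  fixes A :: "'a::linordered_field mat"
  assumes "A \<in> consecutive_TN_GL n" "cleared n j A"
    and "j \<le> k" "k < n" "\<And>i. k < i \<Longrightarrow> i < n \<Longrightarrow> A $$ (i, j) = 0"
  shows "\<exists>L \<in> mult_semigroup (pos_jacobi n). \<exists>U \<in> consecutive_TN_GL n.
           A = L * U \<and> cleared n (Suc j) U \<and> (lower_tri n A \<longrightarrow> lower_tri n U)"
  using assms(3,1,2,4,5)
proof (induction k arbitrary: A rule: dec_induct)
  case base
  have "cleared n (Suc j) A" using base by (auto simp: cleared_def less_Suc_eq)
  moreover have "A = 1\<^sub>m n * A" using base by (auto simp: consecutive_TN_GL_def)
  ultimately show ?case using base one_mat_in_semigroup[of n] by fastforce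
next
  case (step p)
  have Ac: "A \<in> carrier_mat n n" "row_consecutive_nonneg A" "det A \<noteq> 0"
    using step.prems by (auto simp: consecutive_TN_GL_def)
  show ?case
  proof (cases "A $$ (Suc p, j) = 0")
    case True
    have "A $$ (i, j) = 0" if "p < i" "i < n" for i
      using that True step.prems(4) by (cases "i = Suc p") auto
    then show ?thesis using step.IH[of A] step.prems by simp
  next
    case False
    have pivot: "0 < A $$ (p, j)"
      using pivot_positive step False by blast
    have "0 \<le> A $$ (Suc p, j)"
      using row_consecutive_nonneg_entry[OF Ac(2)] Ac(1) step by auto
    with False have pos: "0 < A $$ (Suc p, j)" by simp
    define c where "c = A $$ (Suc p, j) / A $$ (p, j)"
    have c: "0 < c" using pivot pos by (simp add: c_def)
    define A' where "A' = addrow (- c) (Suc p) p A"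
    have A'_index: "A' $$ (i, l) = (if i = Suc p then A $$ (Suc p, l) - c * A $$ (p, l) else A $$ (i, l))"
      if "i < n" "l < n" for i l
      using Ac that by (auto simp: A'_def)
    have j: "A' $$ (i, j) = 0" if "p < i" "i < n" for i
      using that step pivot by (cases "i = Suc p") (auto simp: A'_index c_def)
    have cl: "cleared n j A'"
      using step by (auto simp: cleared_def A'_index)
    have "A' $$ (i, l) = 0" if "Suc p \<le> i" "i < n" "l \<le> j" for i l
      using that j[of i] cl step by (cases "l = j") (auto simp: cleared_def)
    then have "row_consecutive_nonneg A'"
      using row_consecutive_nonneg_eliminate[OF Ac(1,2) _ _ pivot A'_def] step by blast
    moreover have "det A' = det A"
      unfolding A'_def by (rule det_addrow[OF _ _ Ac(1)]) (use step in auto)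
    ultimately have "A' \<in> consecutive_TN_GL n"
      using Ac by (simp add: consecutive_TN_GL_def A'_def)
    from step.IH[OF this cl _ j] step.prems obtain L U where
      L: "L \<in> mult_semigroup (pos_jacobi n)" and U: "U \<in> consecutive_TN_GL n" "A' = L * U" "cleared n (Suc j) U"
        "lower_tri n A' \<longrightarrow> lower_tri n U"
      by force
    let ?E = "addrow_mat n c (Suc p) p"
    have Ac': "A' \<in> carrier_mat n n" using Ac by (simp add: A'_def)
    have "A = addrow c (Suc p) p A'"
      using Ac(1) step.prems by (intro eq_matI) (auto simp: A'_def)
    also have "\<dots> = ?E * A'"
      by (rule addrow_mat[OF Ac']) (use step in auto)
    also have "\<dots> = (?E * L) * U"
      unfolding U(2) using U(1) semigroup_carrier[OF L]
      by (simp add: consecutive_TN_GL_def assoc_mult_mat[of _ n n _ n _ n])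
    finally have "A = (?E * L) * U" .
    moreover have "?E * L \<in> mult_semigroup (pos_jacobi n)"
      using L c step.prems by (intro mult_semigroup.mult addrow_mat_in_semigroup) auto
    moreover have "lower_tri n A \<longrightarrow> lower_tri n A'"
      by (auto simp: lower_tri_def A'_index)
    ultimately show ?thesis using U by blast
  qed
qed

lemma eliminate_below_diagonal:
  fixes A :: "'a::linordered_field mat"
  assumes A: "A \<in> consecutive_TN_GL n" and n: "0 < n"
  obtains L U where "L \<in> mult_semigroup (pos_jacobi n)" "U \<in> consecutive_TN_GL n" "A = L * U"
    "cleared n n U" "lower_tri n A \<longrightarrow> lower_tri n U"
proof -
  have "\<exists>L \<in> mult_semigroup (pos_jacobi n). \<exists>U \<in> consecutive_TN_GL n.
           A = L * U \<and> cleared n j U \<and> (lower_tri n A \<longrightarrow> lower_tri n U)" if "j \<le> n" for j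
    using that
  proof (induction j)
    case 0
    have "A = 1\<^sub>m n * A" using A by (auto simp: consecutive_TN_GL_def)
    then show ?case using A one_mat_in_semigroup[OF n] by (fastforce simp: cleared_def)
  next
    case (Suc j)
    then obtain L U where L: "L \<in> mult_semigroup (pos_jacobi n)" and U: "U \<in> consecutive_TN_GL n"
      "A = L * U" "cleared n j U" "lower_tri n A \<longrightarrow> lower_tri n U"
      by auto
    from eliminate_column[OF U(1,3), of "n - 1"] Suc.prems obtain L' U' where
      L': "L' \<in> mult_semigroup (pos_jacobi n)" and U': "U' \<in> consecutive_TN_GL n"
      "U = L' * U'" "cleared n (Suc j) U'" "lower_tri n U \<longrightarrow> lower_tri n U'"
      by force
    have "A = (L * L') * U'"
      unfolding U(2) U'(2) using U'(1) semigroup_carrier[OF L] semigroup_carrier[OF L']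
      by (simp add: consecutive_TN_GL_def assoc_mult_mat[of _ n n _ n _ n])
    then show ?case using mult_semigroup.mult[OF L L'] U' U by blast
  qed
  from this[of n] that show ?thesis by auto
qed

section \<open>Rotation by a half turn\<close>

text \<open>
  Conjugation by the reversal permutation. It exchanges upper and lower triangular matrices but, unlike
  transposition, sends minors with consecutive rows to minors with consecutive rows.
\<close>
definition rotate_mat :: "nat \<Rightarrow> 'a mat \<Rightarrow> 'a mat" where
  "rotate_mat n A = mat n n (\<lambda>(i, l). A $$ (n - 1 - i, n - 1 - l))"

lemma rotate_mat_carrier [simp]: "rotate_mat n A \<in> carrier_mat n n"
  and rotate_mat_dim [simp]: "dim_row (rotate_mat n A) = n" "dim_col (rotate_mat n A) = n"
  and rotate_mat_index [simp]: "i < n \<Longrightarrow> l < n \<Longrightarrow> rotate_mat n A $$ (i, l) = A $$ (n - 1 - i, n - 1 - l)"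
  by (simp_all add: rotate_mat_def)

lemma rotate_rotate_mat: "A \<in> carrier_mat n n \<Longrightarrow> rotate_mat n (rotate_mat n A) = A"
  by (rule eq_matI) auto

lemma rotate_mat_mult:
  fixes A :: "'a::semiring_0 mat"
  assumes "A \<in> carrier_mat n n" "B \<in> carrier_mat n n"
  shows "rotate_mat n (A * B) = rotate_mat n A * rotate_mat n B"
proof (rule eq_matI)
  fix i l assume "i < dim_row (rotate_mat n A * rotate_mat n B)" "l < dim_col (rotate_mat n A * rotate_mat n B)"
  then have il: "i < n" "l < n" by auto
  have "(\<Sum>k = 0..<n. A $$ (n - 1 - i, k) * B $$ (k, n - 1 - l)) =
    (\<Sum>k = 0..<n. A $$ (n - 1 - i, n - 1 - k) * B $$ (n - 1 - k, n - 1 - l))"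
    by (rule sum.reindex_bij_witness[of _ "\<lambda>k. n - 1 - k" "\<lambda>k. n - 1 - k"]) auto
  then show "rotate_mat n (A * B) $$ (i, l) = (rotate_mat n A * rotate_mat n B) $$ (i, l)"
    using assms il by (simp add: scalar_prod_def)
qed auto

lemma det_rotate_mat:
  fixes A :: "'a::comm_ring_1 mat"
  assumes A: "A \<in> carrier_mat n n"
  shows "det (rotate_mat n A) = det A"
proof -
  \<comment> \<open>Rows and columns are permuted by the same permutation, so the two signs cancel.\<close>
  define p where "p i = (if i < n then n - 1 - i else i)" for i
  have "bij_betw p {0..<n} {0..<n}"
    by (rule bij_betw_byWitness[of _ p]) (auto simp: p_def)
  then have p: "p permutes {0..<n}"
    by (rule bij_imp_permutes) (simp add: p_def)
  define B where "B = mat n n (\<lambda>(i, j). A $$ (p i, j))"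
  define C where "C = mat n n (\<lambda>(i, j). B\<^sup>T $$ (p i, j))"
  have B: "B \<in> carrier_mat n n" and C: "C \<in> carrier_mat n n" by (simp_all add: B_def C_def)
  have "rotate_mat n A = C\<^sup>T"
    by (rule eq_matI) (auto simp: B_def C_def p_def)
  then have "det (rotate_mat n A) = det C" by (simp add: det_transpose[OF C])
  also have "\<dots> = signof p * det B"
    unfolding C_def using B by (subst det_permute_rows[OF _ p]) (auto simp: det_transpose[OF B])
  also have "det B = signof p * det A"
    unfolding B_def by (rule det_permute_rows[OF A p])
  finally show ?thesis by (simp add: sign_def)
qed

lemma rotate_mat_consecutive_TN_GL:
  fixes A :: "'a::linordered_field mat"
  assumes A: "A \<in> consecutive_TN_GL n"
  shows "rotate_mat n A \<in> consecutive_TN_GL n"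
proof -
  have Ac: "A \<in> carrier_mat n n" "row_consecutive_nonneg A" "det A \<noteq> 0"
    using A by (auto simp: consecutive_TN_GL_def)
  have "0 \<le> det (minor_mat (rotate_mat n A) m ((+) r) f)"
    if r: "r + m \<le> n" and f: "index_map m n f" for m r f
  proof -
    define f' where "f' l = n - 1 - f (m - 1 - l)" for l
    have "f' i < f' l" if "i < l" "l < m" for i l
    proof -
      have "f (m - 1 - l) < f (m - 1 - i)" using index_mapD(1)[OF f] that by auto
      moreover have "f (m - 1 - i) < n" using index_mapD(2)[OF f] that by auto
      ultimately show ?thesis by (simp add: f'_def)
    qed
    moreover have "f' l < n" if "l < m" for l
      using index_mapD(2)[OF f that] by (simp add: f'_def)
    ultimately have f': "index_map m n f'"
      by (auto simp: index_map_def strict_mono_on_def)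
    have "minor_mat (rotate_mat n A) m ((+) r) f = rotate_mat m (minor_mat A m ((+) (n - r - m)) f')"
      using r index_mapD(2)[OF f] by (intro eq_matI) (auto simp: f'_def intro!: arg_cong[of _ _ "\<lambda>i. A $$ (i, _)"])
    then have "det (minor_mat (rotate_mat n A) m ((+) r) f) = det (minor_mat A m ((+) (n - r - m)) f')"
      by (simp add: det_rotate_mat)
    moreover have "n - r - m + m \<le> n" using r by simp
    ultimately show ?thesis
      using Ac f' unfolding row_consecutive_nonneg_def by auto
  qed
  then have "row_consecutive_nonneg (rotate_mat n A)"
    by (simp add: row_consecutive_nonneg_def)
  then show ?thesis using Ac by (simp add: consecutive_TN_GL_def det_rotate_mat)
qed

text \<open>
  The half turn is multiplicative and maps positive Jacobi matrices to such matrices.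
\<close>
lemma rotate_mat_in_semigroup:
  assumes "A \<in> mult_semigroup (pos_jacobi n)"
  shows "rotate_mat n A \<in> mult_semigroup (pos_jacobi n)"
  using assms
proof induction
  case (generator E)
  then show ?case
  proof (cases rule: pos_jacobi_cases)
    case (add c k l)
    then have "rotate_mat n E = addrow_mat n c (n - 1 - k) (n - 1 - l)"
      by (intro eq_matI) auto
    then show ?thesis using add by (auto intro!: addrow_mat_in_semigroup)
  next
    case (mult k d)
    then have "rotate_mat n E = multrow_mat n (n - 1 - k) d"
      by (intro eq_matI) auto
    then show ?thesis using mult by (auto intro!: multrow_mat_in_semigroup)
  qed
next
  case (mult A B)
  then show ?case
    by (simp add: rotate_mat_mult semigroup_carrier mult_semigroup.mult)
qed

lemma diagonal_in_semigroup:
  fixes D :: "'a::linordered_field mat"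
  assumes n: "0 < n" and D: "D \<in> carrier_mat n n"
    and off: "\<And>i l. i < n \<Longrightarrow> l < n \<Longrightarrow> i \<noteq> l \<Longrightarrow> D $$ (i, l) = 0"
    and pos: "\<And>i. i < n \<Longrightarrow> 0 < D $$ (i, i)"
  shows "D \<in> mult_semigroup (pos_jacobi n)"
proof -
  \<comment> \<open>\<open>P m\<close> carries only the first \<open>m\<close> diagonal entries; each further entry is one generator.\<close>
  define P where "P m = mat n n (\<lambda>(i, l). if i = l then if i < m then D $$ (i, i) else 1 else 0)" for m
  have "P m \<in> mult_semigroup (pos_jacobi n)" if "m \<le> n" for m
    using that
  proof (induction m)
    case 0
    have "P 0 = 1\<^sub>m n" by (rule eq_matI) (auto simp: P_def)
    then show ?case by (simp add: one_mat_in_semigroup[OF n])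
  next
    case (Suc m)
    have "P (Suc m) = multrow m (D $$ (m, m)) (P m)"
      by (rule eq_matI) (auto simp: P_def less_Suc_eq)
    also have "\<dots> = multrow_mat n m (D $$ (m, m)) * P m"
      by (rule multrow_mat[of _ n n]) (simp add: P_def)
    finally show ?case
      using Suc pos[of m] by (simp add: multrow_mat_in_semigroup mult_semigroup.mult)
  qed
  moreover have "P n = D" using D off by (intro eq_matI) (auto simp: P_def)
  ultimately show ?thesis by force
qed

text \<open>
  The second elimination is applied to the half turn of the upper triangular result of the first one.
  What remains is diagonal, with positive diagonal because its entries are nonnegative and its
  determinant is nonzero.
\<close>
theorem consecutive_TN_GL_in_semigroup:
  fixes A :: "'a::linordered_field mat"
  assumes A: "A \<in> consecutive_TN_GL n" and n: "0 < n"
  shows "A \<in> mult_semigroup (pos_jacobi n)"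
proof -
  obtain L U where L: "L \<in> mult_semigroup (pos_jacobi n)" and U: "U \<in> consecutive_TN_GL n" "A = L * U" "cleared n n U"
    using eliminate_below_diagonal[OF A n] by metis
  have "lower_tri n (rotate_mat n U)"
    using U(3) by (auto simp: lower_tri_def cleared_def)
  then obtain L' V where L': "L' \<in> mult_semigroup (pos_jacobi n)" and
    V: "V \<in> consecutive_TN_GL n" "rotate_mat n U = L' * V" "cleared n n V" "lower_tri n V"
    using eliminate_below_diagonal[OF rotate_mat_consecutive_TN_GL[OF U(1)] n] by metis
  have Vc: "V \<in> carrier_mat n n" "row_consecutive_nonneg V" "det V \<noteq> 0"
    using V(1) by (auto simp: consecutive_TN_GL_def)
  have off: "V $$ (i, l) = 0" if "i < n" "l < n" "i \<noteq> l" for i l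
    using that V(3,4) by (cases i l rule: linorder_cases) (auto simp: cleared_def lower_tri_def)
  have "0 < V $$ (i, i)" if "i < n" for i
  proof -
    have "V $$ (i, i) \<noteq> 0"
    proof
      assume "V $$ (i, i) = 0"
      then have "V $$ (i, l) = 0" if "l < n" for l using off[OF \<open>i < n\<close> that] by (cases "i = l") auto
      then show False using det_zero_row[OF Vc(1) \<open>i < n\<close>] Vc(3) by blast
    qed
    moreover have "0 \<le> V $$ (i, i)" using row_consecutive_nonneg_entry[OF Vc(2)] Vc(1) that by auto
    ultimately show ?thesis by simp
  qed
  then have "V \<in> mult_semigroup (pos_jacobi n)"
    using diagonal_in_semigroup[OF n Vc(1)] off by blast
  then have "rotate_mat n (L' * V) \<in> mult_semigroup (pos_jacobi n)"
    by (intro rotate_mat_in_semigroup mult_semigroup.mult L')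
  moreover have "rotate_mat n (L' * V) = U"
    using U(1) by (simp flip: V(2) add: rotate_rotate_mat consecutive_TN_GL_def)
  ultimately show ?thesis using L U(2) by (auto intro: mult_semigroup.mult)
qed

section \<open>Products of positive Jacobi matrices are totally nonnegative\<close>

text \<open>
  By linearity in the modified row \<open>k\<close>, the minor changes by \<open>c\<close> times the determinant in which row \<open>k\<close>
  is replaced by row \<open>l\<close>. This is zero if row \<open>l\<close> already occurs, and otherwise again a minor of \<open>A\<close>:
  no index lies strictly between \<open>k\<close> and \<open>l\<close>, so the row indices stay increasing.
\<close>
lemma totally_nonneg_addrow:
  fixes A :: "'a::linordered_field mat"
  assumes A: "A \<in> carrier_mat n n" "totally_nonneg A"
    and c: "0 \<le> c" and k: "k < n" and l: "l < n" and kl: "k = Suc l \<or> l = Suc k"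
  shows "totally_nonneg (addrow c k l A)"
  unfolding totally_nonneg_def
proof (intro allI impI)
  fix m g f
  let ?A = "addrow c k l A"
  assume "index_map m (dim_row ?A) g" "index_map m (dim_col ?A) f"
  then have g: "index_map m n g" and f: "index_map m n f" using A by auto
  have nonneg: "0 \<le> det (minor_mat A m g' f)" if "index_map m n g'" for g'
    using A f that unfolding totally_nonneg_def by auto
  note gn = index_mapD(2)[OF g] and fn = index_mapD(2)[OF f]
  show "0 \<le> det (minor_mat ?A m g f)"
  proof (cases "\<exists>i<m. g i = k")
    case False
    then have "minor_mat ?A m g f = minor_mat A m g f"
      using A gn fn by (intro eq_matI) auto
    then show ?thesis using nonneg[OF g] by simp
  next
    case True
    then obtain i where i: "i < m" "g i = k" by blast
    have uniq: "g i' = k \<longleftrightarrow> i' = i" if "i' < m" for i'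
      using index_map_eq_iff[OF g that i(1)] i by simp
    define R where "R = minor_mat A m (g(i := l)) f"
    have R: "det (minor_mat ?A m g f) = det (minor_mat A m g f) + c * det R"
      by (rule det_row_linear[OF _ _ _ i(1)]) (use A gn fn i uniq k in \<open>auto simp: R_def\<close>)
    have "0 \<le> det R"
    proof (cases "\<exists>i'<m. g i' = l")
      case True
      then obtain i' where i': "i' < m" "g i' = l" by blast
      have "i' \<noteq> i" using i i' kl by auto
      then have "det R = 0"
        using i i' by (intro det_identical_rows[of R m i i']) (auto simp: R_def intro!: eq_vecI)
      then show ?thesis by simp
    next
      case False
      have "index_map m n (g(i := l))"
        unfolding index_map_def strict_mono_on_def
      proof (intro conjI allI impI; (elim conjE)?)
        fix a b assume ab: "a \<in> {..<m}" "b \<in> {..<m}" "a < b"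
        then have "g a < g b" using index_mapD(1)[OF g, of a b] by simp
        moreover have "g a \<noteq> l" "g b \<noteq> l" using False ab by auto
        ultimately show "(g(i := l)) a < (g(i := l)) b"
          using kl i ab by auto
      qed (use gn l in auto)
      then show ?thesis using nonneg by (simp add: R_def)
    qed
    then show ?thesis using R nonneg[OF g] c by simp
  qed
qed

lemma totally_nonneg_multrow:
  fixes A :: "'a::linordered_field mat"
  assumes A: "A \<in> carrier_mat n n" "totally_nonneg A" and d: "0 \<le> d"
  shows "totally_nonneg (multrow k d A)"
  unfolding totally_nonneg_def
proof (intro allI impI)
  fix m g f
  let ?A = "multrow k d A"
  assume "index_map m (dim_row ?A) g" "index_map m (dim_col ?A) f"
  then have g: "index_map m n g" and f: "index_map m n f" using A by auto
  have nonneg: "0 \<le> det (minor_mat A m g f)"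
    using A f g unfolding totally_nonneg_def by auto
  note gn = index_mapD(2)[OF g] and fn = index_mapD(2)[OF f]
  show "0 \<le> det (minor_mat ?A m g f)"
  proof (cases "\<exists>i<m. g i = k")
    case False
    then have "minor_mat ?A m g f = minor_mat A m g f"
      using A gn fn by (intro eq_matI) auto
    then show ?thesis using nonneg by simp
  next
    case True
    then obtain i where i: "i < m" "g i = k" by blast
    have uniq: "g i' = k \<longleftrightarrow> i' = i" if "i' < m" for i'
      using index_map_eq_iff[OF g that i(1)] i by simp
    have "minor_mat ?A m g f = multrow i d (minor_mat A m g f)"
      using A gn fn uniq by (intro eq_matI) auto
    then show ?thesis using nonneg d i by (simp add: det_multrow[of _ m])
  qed
qed

text \<open>
  At the first position where the row and column indices differ, the smaller of the two is missing
  among the other indices, which gives a zero row or a zero column.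
\<close>
lemma totally_nonneg_one: "totally_nonneg (1\<^sub>m n :: 'a::linordered_field mat)"
  unfolding totally_nonneg_def
proof (intro allI impI)
  fix m g f
  let ?M = "minor_mat (1\<^sub>m n :: 'a mat) m g f"
  assume "index_map m (dim_row (1\<^sub>m n :: 'a mat)) g" "index_map m (dim_col (1\<^sub>m n :: 'a mat)) f"
  then have g: "index_map m n g" and f: "index_map m n f" by auto
  note less = index_mapD(1)[OF g] index_mapD(1)[OF f]
  note bound = index_mapD(2)[OF g] index_mapD(2)[OF f]
  show "0 \<le> det ?M"
  proof (cases "\<forall>i<m. g i = f i")
    case True
    then have "?M = 1\<^sub>m m"
      using bound index_map_eq_iff[OF f] by (intro eq_matI) auto
    then show ?thesis by simp
  next
    case False
    define i where "i = (LEAST i. i < m \<and> g i \<noteq> f i)"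
    have i: "i < m" "g i \<noteq> f i"
      using False LeastI_ex[of "\<lambda>i. i < m \<and> g i \<noteq> f i"] by (auto simp: i_def)
    have eq: "g a = f a" if "a < i" for a
      using not_less_Least[of a "\<lambda>i. i < m \<and> g i \<noteq> f i"] that i by (auto simp: i_def)
    have "det ?M = 0"
    proof (cases "g i < f i")
      case True
      have "g i \<noteq> f a" if "a < m" for a
        using True less(1)[of a i] less(2)[of i a] eq[of a] i that by (cases a i rule: linorder_cases) auto
      then show ?thesis
        by (intro det_zero_row[OF minor_mat_carrier i(1)]) (simp add: i bound)
    next
      case False
      have "g a \<noteq> f i" if "a < m" for a
        using False less(2)[of a i] less(1)[of i a] eq[of a] i that by (cases a i rule: linorder_cases) auto
      then show ?thesis
        by (intro det_zero_column[OF minor_mat_carrier i(1)]) (simp add: i bound)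
    qed
    then show ?thesis by simp
  qed
qed

text \<open>
  Stating closure as left multiplication on totally nonnegative matrices lets the induction treat one
  generator at a time, without the Cauchy--Binet formula for minors of a general product.
\<close>
lemma semigroup_mult_totally_nonneg:
  assumes "A \<in> mult_semigroup (pos_jacobi n)" "B \<in> carrier_mat n n" "totally_nonneg B"
  shows "totally_nonneg (A * B)"
  using assms
proof (induction arbitrary: B)
  case (generator E)
  from generator(1) show ?case
  proof (cases rule: pos_jacobi_cases)
    case (add c k l)
    then show ?thesis
      using generator totally_nonneg_addrow[of B n c k l] addrow_mat[of B n n l c k] by simp
  next
    case (mult k d)
    then show ?thesis
      using generator totally_nonneg_multrow[of B n d k] multrow_mat[of B n n k d] by simp
  qed
next
  case (mult A A')
  have c: "A \<in> carrier_mat n n" "A' \<in> carrier_mat n n"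
    using mult.hyps by (auto intro: semigroup_carrier)
  have "totally_nonneg (A * (A' * B))"
    using mult.IH(1)[of "A' * B"] mult.IH(2)[of B] mult.prems c by simp
  then show ?case by (simp add: assoc_mult_mat[OF c mult.prems(1)])
qed

lemma semigroup_totally_nonneg:
  assumes "A \<in> mult_semigroup (pos_jacobi n)"
  shows "totally_nonneg A"
  using semigroup_mult_totally_nonneg[OF assms one_carrier_mat totally_nonneg_one] semigroup_carrier[OF assms]
  by simp

lemma semigroup_det_nonzero:
  assumes "A \<in> mult_semigroup (pos_jacobi n)"
  shows "det A \<noteq> 0"
  using assms
proof induction
  case (generator E)
  then show ?case
    by (cases rule: pos_jacobi_cases) (auto simp: det_addrow_mat det_multrow_mat)
next
  case (mult A B)
  then show ?case by (simp add: det_mult[of A n B] semigroup_carrier)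
qed

text \<open>
  The Whitney--Loewner factorization theorem, over an arbitrary linearly ordered field.
\<close>
theorem totally_nonneg_invertible_iff_semigroup:
  fixes A :: "'a::linordered_field mat"
  assumes n: "0 < n"
  shows "A \<in> carrier_mat n n \<and> totally_nonneg A \<and> det A \<noteq> 0 \<longleftrightarrow> A \<in> mult_semigroup (pos_jacobi n)"
proof
  assume "A \<in> carrier_mat n n \<and> totally_nonneg A \<and> det A \<noteq> 0"
  then have "A \<in> consecutive_TN_GL n"
    by (simp add: consecutive_TN_GL_def totally_nonneg_imp_row_consecutive)
  then show "A \<in> mult_semigroup (pos_jacobi n)"
    using n by (rule consecutive_TN_GL_in_semigroup)
next
  assume "A \<in> mult_semigroup (pos_jacobi n)"
  then show "A \<in> carrier_mat n n \<and> totally_nonneg A \<and> det A \<noteq> 0"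
    by (intro conjI semigroup_carrier semigroup_totally_nonneg semigroup_det_nonzero)
qed

lemma GL_TN_eq_semigroup:
  assumes "0 < n"
  shows "GL n \<inter> TN = mult_semigroup (pos_jacobi n)"
proof -
  have "GL n \<inter> TN = {A \<in> carrier_mat n n. totally_nonneg A \<and> det A \<noteq> 0}"
    by (auto simp: GL_def TN_iff_totally_nonneg invertible_mat_iff_det)
  also have "\<dots> = mult_semigroup (pos_jacobi n)"
    using totally_nonneg_invertible_iff_semigroup[OF assms] by blast
  finally show ?thesis .
qed

section \<open>Valuation of nonnegative matrices\<close>

lemma puiseux_nonneg_iff: "0 \<le> f \<longleftrightarrow> f = 0 \<or> puiseux_pos f"
  by (auto simp: less_eq_puiseux_def)

lemma val_0: "val 0 = 0"
  by (simp add: val_def zero_tropical_def)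

lemma val_monom: "val (puiseux_monom 1 x) = Fin x"
proof -
  have "coeff_at (puiseux_monom 1 x) x \<noteq> coeff_at 0 x" by (simp add: coeff_at_monom)
  then have "puiseux_monom 1 x \<noteq> 0" by metis
  moreover have "lead_exp (puiseux_monom 1 x) = x"
    by (rule lead_exp_eqI) (auto simp: coeff_at_monom split: if_splits)
  ultimately show ?thesis by (simp add: val_def)
qed

lemma monom_pos: "0 < puiseux_monom 1 x"
proof -
  have "puiseux_monom 1 x \<noteq> 0" "lead_exp (puiseux_monom 1 x) = x"
    using val_monom[of x] by (auto simp: val_def split: if_splits)
  then show ?thesis by (simp add: less_puiseux_def puiseux_pos_def coeff_at_monom)
qed

lemma val_1: "val 1 = 1"
  using val_monom[of 0] by (simp add: puiseux_monom_1 one_tropical_def)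

lemma val_mult: "val (f * g) = val f * val g"
  by (cases "val f"; cases "val g") (auto simp: val_def lead_exp_mult split: if_splits)

text \<open>
  The leading coefficients of nonzero nonnegative series are positive, so they cannot cancel.
\<close>
lemma val_add:
  assumes "0 \<le> f" "0 \<le> g"
  shows "val (f + g) = val f + val g"
proof (cases "f = 0 \<or> g = 0")
  case True
  then show ?thesis by (auto simp: val_0)
next
  case False
  then have f: "0 < coeff_at f (lead_exp f)" "f \<noteq> 0" and g: "0 < coeff_at g (lead_exp g)" "g \<noteq> 0"
    using assms by (auto simp: puiseux_nonneg_iff puiseux_pos_def)
  have "f + g \<noteq> 0" using False assms by (simp add: add_nonneg_eq_0_iff)
  moreover have "lead_exp (f + g) = max (lead_exp f) (lead_exp g)"
  proof (rule lead_exp_eqI)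
    show "coeff_at (f + g) (max (lead_exp f) (lead_exp g)) \<noteq> 0"
      using f g coeff_at_eq_0[of f "lead_exp g"] coeff_at_eq_0[of g "lead_exp f"]
      by (cases "lead_exp f" "lead_exp g" rule: linorder_cases) (auto simp: max_def)
    fix x assume "coeff_at (f + g) x \<noteq> 0"
    then have "coeff_at f x \<noteq> 0 \<or> coeff_at g x \<noteq> 0" by auto
    then show "x \<le> max (lead_exp f) (lead_exp g)"
      using lead_exp_ge[OF f(2)] lead_exp_ge[OF g(2)] by (auto simp: le_max_iff_disj)
  qed
  ultimately show ?thesis
    using f g by (simp add: val_def plus_tropical_def max_def)
qed

lemma val_sum:
  assumes "\<And>i. i \<in> I \<Longrightarrow> 0 \<le> f i"
  shows "val (sum f I) = (\<Sum>i\<in>I. val (f i))"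
  using assms
  by (induction I rule: infinite_finite_induct) (simp_all add: val_0 val_add sum_nonneg)

lemma val_mat_mult:
  assumes A: "A \<in> carrier_mat n n" and B: "B \<in> carrier_mat n n"
    and nonneg: "\<And>i j. i < n \<Longrightarrow> j < n \<Longrightarrow> 0 \<le> A $$ (i, j)" "\<And>i j. i < n \<Longrightarrow> j < n \<Longrightarrow> 0 \<le> B $$ (i, j)"
  shows "map_mat val (A * B) = map_mat val A * map_mat val B"
proof (rule eq_matI)
  fix i l assume "i < dim_row (map_mat val A * map_mat val B)" "l < dim_col (map_mat val A * map_mat val B)"
  then have il: "i < n" "l < n" using A B by auto
  have "map_mat val (A * B) $$ (i, l) = val (\<Sum>k = 0..<n. A $$ (i, k) * B $$ (k, l))"
    using A B il by (simp add: scalar_prod_def)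
  also have "\<dots> = (\<Sum>k = 0..<n. val (A $$ (i, k)) * val (B $$ (k, l)))"
    using nonneg il by (subst val_sum) (auto simp: val_mult)
  also have "\<dots> = (map_mat val A * map_mat val B) $$ (i, l)"
    using A B il by (simp add: scalar_prod_def)
  finally show "map_mat val (A * B) $$ (i, l) = (map_mat val A * map_mat val B) $$ (i, l)" .
qed (use A B in auto)

lemma val_mat_mult_semigroup:
  assumes "A \<in> mult_semigroup (pos_jacobi n)" "B \<in> mult_semigroup (pos_jacobi n)"
  shows "map_mat val (A * B) = map_mat val A * map_mat val B"
proof (rule val_mat_mult)
  fix i j assume "i < n" "j < n"
  then show "0 \<le> A $$ (i, j)" "0 \<le> B $$ (i, j)"
    using assms[THEN semigroup_totally_nonneg, THEN totally_nonneg_imp_row_consecutive]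
      assms[THEN semigroup_carrier] by (auto intro!: row_consecutive_nonneg_entry)
qed (use assms in \<open>auto simp: semigroup_carrier\<close>)

lemma val_pos: "0 < f \<Longrightarrow> val f \<noteq> NegInf"
  by (simp add: val_def)

text \<open>
  The entry at \<open>(k, l)\<close> may coincide with the one of the identity matrix, so the set of deviating
  entries can be empty as well as a singleton.
\<close>
lemma tropical_jacobiI:
  assumes T: "T \<in> carrier_mat n n" and fin: "T $$ (k, l) \<noteq> NegInf" and kl: "k = l \<or> k = Suc l \<or> l = Suc k"
    and eq: "\<And>i j. i < n \<Longrightarrow> j < n \<Longrightarrow> (i, j) \<noteq> (k, l) \<Longrightarrow> T $$ (i, j) = 1\<^sub>m n $$ (i, j)"
  shows "T \<in> tropical_jacobi n"
proof -
  let ?D = "{(i, j). i < n \<and> j < n \<and> T $$ (i, j) \<noteq> 1\<^sub>m n $$ (i, j)}"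
  have D: "?D \<subseteq> {(k, l)}" using eq by blast
  then have "card ?D \<le> 1" using card_mono[OF _ D] by simp
  moreover have "\<forall>(i, j) \<in> ?D. T $$ (i, j) \<noteq> NegInf \<and> (i = j \<or> i = Suc j \<or> j = Suc i)"
    using D fin kl by auto
  ultimately show ?thesis using T by (simp add: tropical_jacobi_def Let_def)
qed

text \<open>
  A tropical Jacobi matrix lifts to a positive Jacobi matrix with monic monomials. The tropical identity
  is covered by a diagonal generator with factor 1; this needs a diagonal position, hence \<open>0 < n\<close>.
\<close>
lemma val_pos_jacobi:
  assumes n: "0 < n"
  shows "map_mat val ` pos_jacobi n = tropical_jacobi n"
proof (intro equalityI subsetI)
  fix T assume "T \<in> map_mat val ` pos_jacobi n"
  then obtain E where E: "E \<in> pos_jacobi n" "T = map_mat val E" by blast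
  from E(1) show "T \<in> tropical_jacobi n"
  proof (cases rule: pos_jacobi_cases)
    case (add c k l)
    show ?thesis
      by (rule tropical_jacobiI[of _ _ k l]) (use add E in \<open>auto simp: val_0 val_1 val_pos\<close>)
  next
    case (mult k d)
    show ?thesis
      by (rule tropical_jacobiI[of _ _ k k]) (use mult E in \<open>auto simp: val_0 val_1 val_pos\<close>)
  qed
next
  fix T assume T: "T \<in> tropical_jacobi n"
  let ?D = "{(i, j). i < n \<and> j < n \<and> T $$ (i, j) \<noteq> 1\<^sub>m n $$ (i, j)}"
  from T have Tc: "T \<in> carrier_mat n n" and D: "card ?D \<le> 1"
    and D_entry: "\<And>i j. (i, j) \<in> ?D \<Longrightarrow> T $$ (i, j) \<noteq> NegInf \<and> (i = j \<or> i = Suc j \<or> j = Suc i)"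
    by (auto simp: tropical_jacobi_def Let_def)
  have "\<exists>k l. k < n \<and> l < n \<and> T $$ (k, l) \<noteq> NegInf \<and> (k = l \<or> k = Suc l \<or> l = Suc k) \<and> ?D \<subseteq> {(k, l)}"
  proof (cases "?D = {}")
    case True
    then have "T $$ (0, 0) = 1\<^sub>m n $$ (0, 0)" using n by blast
    then have "T $$ (0, 0) \<noteq> NegInf" using n by (simp add: one_tropical_def)
    moreover have "?D \<subseteq> {(0, 0)}" unfolding True by (rule empty_subsetI)
    ultimately show ?thesis using n by blast
  next
    case False
    have "finite ?D" by (rule finite_subset[of _ "{..<n} \<times> {..<n}"]) auto
    with D have uniq: "\<forall>x\<in>?D. \<forall>y\<in>?D. x = y" by (simp only: card_le_Suc0_iff_eq One_nat_def)
    from False obtain k l where "(k, l) \<in> ?D" by blast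
    with uniq have "(k, l) \<in> ?D" "?D \<subseteq> {(k, l)}" by blast+
    then show ?thesis using D_entry[of k l] by blast
  qed
  then obtain k l where kl: "k < n" "l < n" "k = l \<or> k = Suc l \<or> l = Suc k"
    and "T $$ (k, l) \<noteq> NegInf" and off: "?D \<subseteq> {(k, l)}" by blast
  then obtain x where x: "T $$ (k, l) = Fin x" by (cases "T $$ (k, l)") auto
  have T_index: "T $$ (i, j) = (if i = k \<and> j = l then Fin x else if i = j then 1 else 0)"
    if "i < n" "j < n" for i j
    using off that x by auto
  show "T \<in> map_mat val ` pos_jacobi n"
  proof (cases "k = l")
    case True
    have "T = map_mat val (multrow_mat n k (puiseux_monom 1 x))"
      using Tc True by (intro eq_matI) (auto simp: T_index val_0 val_1 val_monom)
    moreover have "multrow_mat n k (puiseux_monom 1 x) \<in> pos_jacobi n"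
      using kl monom_pos unfolding pos_jacobi_def by blast
    ultimately show ?thesis by blast
  next
    case False
    have "T = map_mat val (addrow_mat n (puiseux_monom 1 x) k l)"
      using Tc False by (intro eq_matI) (auto simp: T_index val_0 val_1 val_monom)
    moreover have "addrow_mat n (puiseux_monom 1 x) k l \<in> pos_jacobi n"
      using kl False monom_pos unfolding pos_jacobi_def by blast
    ultimately show ?thesis by blast
  qed
qed

lemma val_semigroup:
  assumes n: "0 < n"
  shows "map_mat val ` mult_semigroup (pos_jacobi n) = mult_semigroup (tropical_jacobi n)"
proof (intro equalityI subsetI)
  fix T assume "T \<in> map_mat val ` mult_semigroup (pos_jacobi n)"
  then obtain A where "A \<in> mult_semigroup (pos_jacobi n)" "T = map_mat val A" by blast
  then show "T \<in> mult_semigroup (tropical_jacobi n)"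
  proof (induction arbitrary: T)
    case (generator E)
    then show ?case using val_pos_jacobi[OF n] by (auto intro: mult_semigroup.generator)
  next
    case (mult A B)
    then show ?case by (simp add: val_mat_mult_semigroup mult_semigroup.mult)
  qed
next
  fix T assume "T \<in> mult_semigroup (tropical_jacobi n)"
  then show "T \<in> map_mat val ` mult_semigroup (pos_jacobi n)"
  proof induction
    case (generator T)
    then show ?case using val_pos_jacobi[OF n] by (auto intro: mult_semigroup.generator)
  next
    case (mult S T)
    then obtain A B where AB: "A \<in> mult_semigroup (pos_jacobi n)" "B \<in> mult_semigroup (pos_jacobi n)"
      and "S = map_mat val A" "T = map_mat val B" by blast
    then have "S * T = map_mat val (A * B)" by (simp add: val_mat_mult_semigroup)
    with mult_semigroup.mult[OF AB] show ?case by blast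
  qed
qed

theorem theoremB:
  fixes n :: nat
  assumes "n \<ge> 1"
  shows "map_mat val ` (GL n \<inter> TN) = mult_semigroup (tropical_jacobi n)"
  using GL_TN_eq_semigroup[of n] val_semigroup[of n] assms by simp

end
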